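(* Consider the system $x_{k+1}=f(x_k)$, let $\theta^\ast_{N,\rho,A}=(\theta^\ast_{k,N,\rho,A})_{k\in\mathcal T}$ be the solution of the program $\hat P_{N,\rho,A}$ (defined in the context), let $\mathcal R^\ast_{k,N,\rho,A}:=\mathcal R_k(\theta^\ast_{k,N,\rho,A})$ for $k\in\mathcal T$ and $\mathcal R^\ast_N:=\{\mathcal R^\ast_{k,N,\rho,A}\}_{k\in\mathcal T}$, and suppose that the assumptions (Independence), (Convexity), (Uniqueness) and (Non-accumulation) of the context hold. Let $s_A^\ast$ be the adversarial complexity and let $\underline\epsilon(\cdot),\overline\epsilon(\cdot)$ be the violation levels (depending on $N$ and $\beta$) defined in the context. Then, for any confidence parameter $\beta\in(0,1)$, $$\mathbb P^N\left\{\{x^{(i)}\}_{i\in\mathcal N}:\ \underline\epsilon(s_A^\ast)\le \mathbb V_A(\mathcal R^\ast_N)\le \overline\epsilon(s_A^\ast)\right\}\ge 1-\beta,$$ where $\mathbb V_A(\mathcal R^\ast_N)$ is the adversarial probability of trajectory exclusion $$\mathbb V_A(\mathcal R^\ast_N):=\mathbb P\left\{x:\ \exists\,\tilde x\in A_x,\ \exists\, k\in\mathcal T \text{ such that } \tilde x_k\notin \mathcal R^\ast_{k,N,\rho,A}\right\}.$$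
   Context: **System and data.** $T$ is the horizon length, $\mathcal T=\{0,\dots,T\}$, $N$ is the number of samples, $\mathcal N=\{1,\dots,N\}$. The system is $x_{k+1}=f(x_k)$, with $x_k\in X_k\subseteq\mathbb R^{n_x}$ and $f$ a (possibly unknown) continuous function, which may incorporate uncertainty, e.g. $f(x_k)=\tilde f(x_k,w_k)$ with an uncertain (possibly unbounded) disturbance $w_k$. A trajectory is $x=(x_k)_{k\in\mathcal T}$, modeled as a random vector in $X=\prod_{k\in\mathcal T}X_k\subset\mathbb R^{(T+1)n_x}$ with (possibly unknown) probability distribution $\mathbb P$. $\mathbb P^N$ is the $N$-fold product of $\mathbb P$. **Candidate reachable sets.** For each $k\in\mathcal T$ and $\theta_k\in\Theta_k\subseteq\mathbb R^{n_\theta}$, $\mathcal R_k(\theta_k)=\{z_k\in\mathbb R^{n_x}: g_k(z_k,\theta_k)\le 0\}$ for a given constraint function $g_k$. Let $\theta=(\theta_k)_{k\in\mathcal T}\in\Theta$, where $\Theta$ is the set of admissible concatenated parameters, and $g(x,\theta)=\max_{k\in\mathcal T}g_k(x_k,\theta_k)$. $S(\mathcal R_k(\theta_k))$ is a real-valued size proxy of the set (e.g. its volume), and $\rho>0$ is a penalty parameter. **Adversarial sets.** Given a distance metric $d$ and a radius $R$, $A_x:=\{\tilde x: d(x,\tilde x)\le R\}$. $\hat A_x$ is an available approximation of $A_x$ (equal to $A_x$ if $A_x$ is known). For each $i\in\mathcal N$, $x^{(i,j)}$, $j\in\mathcal M_i$, denote the (finitely many) vertices of a polytopic approximation of $\hat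 A_{x^{(i)}}$; the approximation is exact if the adversarial set is a known polytope. **Program $\hat P_{N,\rho,A}$.** $$\min_{\theta\in\Theta,\ \xi\in\mathbb R^N_{\ge0}}\ \sum_{k\in\mathcal T}\Big[S(\mathcal R_k(\theta_k))+\rho\sum_{i\in\mathcal N}\xi_i\Big]\quad\text{s.t.}\quad g(x^{(i,j)},\theta)\le\xi_i,\ \ \forall j\in\mathcal M_i,\ \forall i\in\mathcal N.$$ **Assumptions.** - (Independence) $x^{(1)},\dots,x^{(N)}$ are independent sample trajectories from $\mathbb P$. - (Convexity) For each $k\in\mathcal T$, $S(\mathcal R_k(\theta_k))$ is convex in $\theta_k$; and for each fixed $x$, $g(x,\theta)$ is convex in $\theta$. - (Uniqueness) $\hat P_{N,\rho,A}$ admits a unique optimal solution $\theta^\ast_{N,\rho,A}$. - (Non-accumulation) For every $\theta\in\Theta$, $\mathbb P\{x\in X:\ \exists\,\tilde x\in\hat A_x\text{ such that }g(\tilde x,\theta)=0\}=0$. **Adversarial complexity.** $s_A^\ast$ is the number of indices $i\in\mathcal N$ such that at least one of the following holds: (i) there exist $\tilde x\in\hat A_{x^{(i)}}$ and $k\in\mathcal T$ with $g_k(\tilde x_k,\theta^\ast_{k,N,\rho,A})>0$; (ii) there exist $\tilde x\in\hat A_{x^{(i)}}$ and $k\in\mathcal T$ with $g_k(\tilde x_k,\theta^\ast_{k,N,\rho,A})=0$; (iii) there exist $\tilde x\in A_{x^{(i)}}$ and $k\in\mathcal T$ with $g_k(\tilde x_k,\theta^\ast_{k,N,\rho,A})>0$.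 **Violation levels.** For each $\nu\in\{0,1,\dots,N-1\}$ consider the polynomial equation in $t\ge0$ $$\binom N\nu t^{N-\nu}-\frac{\beta}{2N}\sum_{i=\nu}^{N-1}\binom i\nu t^{i-\nu}-\frac{\beta}{6N}\sum_{i=N+1}^{4N}\binom i\nu t^{i-\nu}=0,$$ with its two nonnegative roots $\underline t(\nu)\le\overline t(\nu)$. For $\nu=N$ consider $$1-\frac{\beta}{6N}\sum_{i=N+1}^{4N}\binom iN t^{i-N}=0,$$ which has a unique nonnegative root $\underline t(N)$, and set $\overline t(N):=0$. For all $\nu\in\{0,1,\dots,N\}$ define $\overline\epsilon(\nu):=1-\underline t(\nu)$ and $\underline\epsilon(\nu):=\max\{0,1-\overline t(\nu)\}$.
   Formalization: For ν=N the two values are exchanged (lower root 0, upper root the unique root); the approximation Â_x is assumed contained in A_x, and the vertices x^{(i,j)} are assumed to lie in Â_{x^{(i)}}; the measurability needed for the probabilities is made explicit. *)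

theory Defs
  imports "HOL-Probability.Probability"
begin

(* Time steps are the elements of a finite linear order 't, that is, of {0, ..., T} with
   T + 1 = CARD('t). Trajectories (families of states) and concatenated parameters live in the
   Euclidean space real^'n^'t; the synonym avoids the sort constraint that the infix syntax puts
   on 't. *)
type_synonym ('n, 't) series = "((real, 'n) vec, 't) vec"

definition next_step :: "'t::linorder \<Rightarrow> 't \<Rightarrow> bool" where
  "next_step k l \<longleftrightarrow> k < l \<and> (\<forall>m. \<not> (k < m \<and> m < l))"

definition traj_space :: "('t \<Rightarrow> (real^'n) set) \<Rightarrow> ('n,'t::finite) series set" where
  "traj_space X = {x. \<forall>k. x $ k \<in> X k}"

(* The uncertainty in the dynamics is a disturbance w, whose values range over the type 'w;
   'w = unit gives a deterministic system. *)
definition follows_dynamics ::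
  "(real^'n \<Rightarrow> 'w \<Rightarrow> real^'n) \<Rightarrow> ('n,'t::{finite,linorder}) series \<Rightarrow> bool" where
  "follows_dynamics f x \<longleftrightarrow> (\<forall>k l. next_step k l \<longrightarrow> (\<exists>w. x $ l = f (x $ k) w))"

definition reach_set ::
  "('t \<Rightarrow> real^'n \<Rightarrow> real^'p \<Rightarrow> real) \<Rightarrow> 't \<Rightarrow> real^'p \<Rightarrow> (real^'n) set" where
  "reach_set g k p = {z. g k z p \<le> 0}"

definition gmax ::
  "('t \<Rightarrow> real^'n \<Rightarrow> real^'p \<Rightarrow> real) \<Rightarrow> ('n,'t::finite) series \<Rightarrow> ('p,'t) series \<Rightarrow> real" where
  "gmax g x \<theta> = Max (range (\<lambda>k. g k (x $ k) (\<theta> $ k)))"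

definition adv_set :: "('x \<Rightarrow> 'x \<Rightarrow> real) \<Rightarrow> real \<Rightarrow> 'x \<Rightarrow> 'x set" where
  "adv_set d R x = {x'. d x x' \<le> R}"

definition vertices :: "'x::real_vector set \<Rightarrow> 'x set" where
  "vertices Q = {v. v extreme_point_of Q}"

(* The scenario program. A sample is a function \<omega> with trajectories \<omega> 1, ..., \<omega> N, and
   Q x is the polytope that stands in for the approximate adversarial set of x. *)

definition cost ::
  "('t \<Rightarrow> real^'n \<Rightarrow> real^'p \<Rightarrow> real) \<Rightarrow> ((real^'n) set \<Rightarrow> real) \<Rightarrow> real \<Rightarrow> nat
    \<Rightarrow> ('p,'t::finite) series \<Rightarrow> (nat \<Rightarrow> real) \<Rightarrow> real" where
  "cost g S \<rho> N \<theta> \<xi> = (\<Sum>k\<in>UNIV. S (reach_set g k (\<theta> $ k)) + \<rho> * (\<Sum>i\<in>{1..N}. \<xi> i))"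

definition feasible ::
  "('t \<Rightarrow> real^'n \<Rightarrow> real^'p \<Rightarrow> real) \<Rightarrow> ('p,'t::finite) series set
    \<Rightarrow> (('n,'t) series \<Rightarrow> ('n,'t) series set) \<Rightarrow> nat \<Rightarrow> (nat \<Rightarrow> ('n,'t) series)
    \<Rightarrow> ('p,'t) series \<Rightarrow> (nat \<Rightarrow> real) \<Rightarrow> bool" where
  "feasible g \<Theta> Q N \<omega> \<theta> \<xi> \<longleftrightarrow>
     \<theta> \<in> \<Theta> \<and> (\<forall>i\<in>{1..N}. 0 \<le> \<xi> i \<and> (\<forall>v\<in>vertices (Q (\<omega> i)). gmax g v \<theta> \<le> \<xi> i))"

(* Optimality of \<theta> together with some slack vector. The slacks are functions on nat whose values
   outside {1..N} are irrelevant, so uniqueness is only meaningful for \<theta>. *)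
definition optimal ::
  "('t \<Rightarrow> real^'n \<Rightarrow> real^'p \<Rightarrow> real) \<Rightarrow> ((real^'n) set \<Rightarrow> real) \<Rightarrow> real
    \<Rightarrow> ('p,'t::finite) series set \<Rightarrow> (('n,'t) series \<Rightarrow> ('n,'t) series set) \<Rightarrow> nat
    \<Rightarrow> (nat \<Rightarrow> ('n,'t) series) \<Rightarrow> ('p,'t) series \<Rightarrow> bool" where
  "optimal g S \<rho> \<Theta> Q N \<omega> \<theta> \<longleftrightarrow>
     (\<exists>\<xi>. feasible g \<Theta> Q N \<omega> \<theta> \<xi> \<and>
       (\<forall>\<theta>' \<xi>'. feasible g \<Theta> Q N \<omega> \<theta>' \<xi>' \<longrightarrow> cost g S \<rho> N \<theta> \<xi> \<le> cost g S \<rho> N \<theta>' \<xi>'))"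

definition opt_param ::
  "('t \<Rightarrow> real^'n \<Rightarrow> real^'p \<Rightarrow> real) \<Rightarrow> ((real^'n) set \<Rightarrow> real) \<Rightarrow> real
    \<Rightarrow> ('p,'t::finite) series set \<Rightarrow> (('n,'t) series \<Rightarrow> ('n,'t) series set) \<Rightarrow> nat
    \<Rightarrow> (nat \<Rightarrow> ('n,'t) series) \<Rightarrow> ('p,'t) series" where
  "opt_param g S \<rho> \<Theta> Q N \<omega> = (THE \<theta>. optimal g S \<rho> \<Theta> Q N \<omega> \<theta>)"

(* A x is the adversarial set of x and Ah x its available approximation. *)
definition adv_complexity ::
  "('t \<Rightarrow> real^'n \<Rightarrow> real^'p \<Rightarrow> real) \<Rightarrow> (('n,'t) series \<Rightarrow> ('n,'t::finite) series set)
    \<Rightarrow> (('n,'t) series \<Rightarrow> ('n,'t) series set) \<Rightarrow> nat \<Rightarrow> (nat \<Rightarrow> ('n,'t) series) \<Rightarrow> ('p,'t) series \<Rightarrow> nat" where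
  "adv_complexity g A Ah N \<omega> \<theta> = card {i\<in>{1..N}.
     (\<exists>x'\<in>Ah (\<omega> i). \<exists>k. g k (x' $ k) (\<theta> $ k) > 0) \<or>
     (\<exists>x'\<in>Ah (\<omega> i). \<exists>k. g k (x' $ k) (\<theta> $ k) = 0) \<or>
     (\<exists>x'\<in>A (\<omega> i). \<exists>k. g k (x' $ k) (\<theta> $ k) > 0)}"

definition adv_excluded ::
  "(('n,'t) series \<Rightarrow> ('n,'t::finite) series set) \<Rightarrow> ('t \<Rightarrow> (real^'n) set) \<Rightarrow> ('n,'t) series \<Rightarrow> bool" where
  "adv_excluded A \<R> x \<longleftrightarrow> (\<exists>x'\<in>A x. \<exists>k. x' $ k \<notin> \<R> k)"

definition exclusion_prob ::
  "('n,'t) series measure \<Rightarrow> (('n,'t) series \<Rightarrow> ('n,'t::finite) series set) \<Rightarrow> ('t \<Rightarrow> (real^'n) set)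
    \<Rightarrow> real" where
  "exclusion_prob P A \<R> = measure P {x \<in> space P. adv_excluded A \<R> x}"

(* For \<nu> = N the first sum is empty and the leading term is 1. *)
definition level_poly :: "nat \<Rightarrow> real \<Rightarrow> nat \<Rightarrow> real \<Rightarrow> real" where
  "level_poly N \<beta> \<nu> t =
     real (N choose \<nu>) * t ^ (N - \<nu>)
     - \<beta> / (2 * real N) * (\<Sum>i\<in>{\<nu>..<N}. real (i choose \<nu>) * t ^ (i - \<nu>))
     - \<beta> / (6 * real N) * (\<Sum>i\<in>{N+1..4*N}. real (i choose \<nu>) * t ^ (i - \<nu>))"

definition level_roots :: "nat \<Rightarrow> real \<Rightarrow> nat \<Rightarrow> real set" where
  "level_roots N \<beta> \<nu> = {t. 0 \<le> t \<and> level_poly N \<beta> \<nu> t = 0}"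

(* There are two nonnegative roots for \<nu> < N, but only one for \<nu> = N. The latter is positive and is
   the upper one, the lower one being set to 0. Exchanging the two would make eps_lower N = 1
   exceed eps_upper N. *)
definition t_lower :: "nat \<Rightarrow> real \<Rightarrow> nat \<Rightarrow> real" where
  "t_lower N \<beta> \<nu> = (if \<nu> = N then 0 else Min (level_roots N \<beta> \<nu>))"

definition t_upper :: "nat \<Rightarrow> real \<Rightarrow> nat \<Rightarrow> real" where
  "t_upper N \<beta> \<nu> = Max (level_roots N \<beta> \<nu>)"

definition eps_upper :: "nat \<Rightarrow> real \<Rightarrow> nat \<Rightarrow> real" where
  "eps_upper N \<beta> \<nu> = 1 - t_lower N \<beta> \<nu>"

definition eps_lower :: "nat \<Rightarrow> real \<Rightarrow> nat \<Rightarrow> real" where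
  "eps_lower N \<beta> \<nu> = max 0 (1 - t_upper N \<beta> \<nu>)"

end

theory Submission
  imports Defs
begin

text \<open>
  Call a trajectory critical for \<open>\<theta>\<close> if its adversarial set leaves the reachable sets of
  \<open>\<theta>\<close> or its approximate adversarial set touches their boundary. By non-accumulation the
  probability of being critical (the risk of \<open>\<theta>\<close>) is the adversarial exclusion probability,
  and the complexity is the number of critical samples. So the claim is that the pair
  (complexity, risk) of the optimal parameter lies in a prescribed band with probability at least
  \<open>1 - \<beta>\<close>.

  The driving fact is that samples that are not critical are irrelevant: if the slacks are
  eliminated, the program minimises a convex function plus one penalty per sample, the penalty of
  a noncritical sample vanishes at the optimum and along the beginning of every segment from it,
  and therefore such samples can be
  removed or added without disturbing the unique optimum
  (\<open>unique_minimiser_inactive_penalties\<close>). The locale \<open>consistent_decision\<close> isolates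
  this property. It determines what happens for other sample sizes \<open>m\<close>: if the critical
  samples are those with index in \<open>I\<close>, the decision depends on these alone, and the other
  samples only have to be noncritical for it, which has probability \<open>1 - risk\<close> each. Write
  \<open>\<nu> k\<close> for the law of the risk on the event that, among \<open>N\<close> samples, exactly the first
  \<open>k\<close> are critical. Among \<open>m\<close> samples, on the same event, the risk has the law
  \<open>(1 - v) ^ (m - N) d\<nu> k\<close>, with a negative exponent if \<open>m < N\<close> (where decisions of risk
  \<open>1\<close> are left aside). Events with different
  critical index sets are disjoint, because the decision is unique, so
  \<open>(\<Sum>k\<le>N. (m choose k) * (\<integral> (1 - v) ^ (m - N) d\<nu> k)) \<le> 1\<close> for every \<open>m\<close>
  (\<open>sample_constraint\<close>).

  The probability of leaving the band is \<open>\<Sum>k\<le>N. (N choose k) * \<nu> k (bad k)\<close>, a linear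
  functional of the measures \<open>\<nu> k\<close>. Weak linear programming duality against the constraints
  bounds it by the sum of any dual feasible multipliers (\<open>risk_complexity_bound\<close>). The multipliers
  \<open>\<beta> / (2 N)\<close> for \<open>m < N\<close> and \<open>\<beta> / (6 N)\<close> for \<open>N < m \<le> 4 N\<close> add up to \<open>\<beta>\<close>,
  and with them the dual constraint at a risk \<open>v < 1\<close> says precisely that the level polynomial is
  nonpositive at \<open>1 - v\<close> (\<open>multiplier_dual_feasible\<close>). This holds when \<open>1 - v\<close> lies below the
  smallest or above the largest nonnegative root, and these two roots delimit the band. For
  complexity \<open>N\<close> only the largest root matters, since the band then has no upper limit below
  \<open>1\<close>.
\<close>

section \<open>Sign of the level polynomials\<close>

lemma level_poly_as_polynomial: "\<exists>p. \<forall>t. poly p t = level_poly N \<beta> \<nu> t"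
proof -
  let ?p = "monom (real (N choose \<nu>)) (N - \<nu>)
    - smult (\<beta> / (2 * real N)) (\<Sum>i\<in>{\<nu>..<N}. monom (real (i choose \<nu>)) (i - \<nu>))
    - smult (\<beta> / (6 * real N)) (\<Sum>i\<in>{N+1..4*N}. monom (real (i choose \<nu>)) (i - \<nu>))"
  have "poly ?p t = level_poly N \<beta> \<nu> t" for t
    by (simp add: level_poly_def poly_monom poly_sum)
  then show ?thesis by blast
qed

lemma continuous_on_level_poly: "continuous_on A (level_poly N \<beta> \<nu>)"
  unfolding level_poly_def[abs_def] by (intro continuous_intros)

text \<open>
  The coefficient of the highest power \<open>t ^ (4 * N - \<nu>)\<close> is negative, and \<open>t ^ (N - \<nu>)\<close>
  is the only power with a positive one.
\<close>

lemma level_poly_eventually_neg: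
  assumes "1 \<le> N" "0 < \<beta>" "\<nu> \<le> N"
  obtains T where "\<And>t. T \<le> t \<Longrightarrow> level_poly N \<beta> \<nu> t < 0"
proof
  define a where "a = real (N choose \<nu>)"
  define b where "b = \<beta> / (6 * real N)"
  have a: "a \<ge> 0" and b: "b > 0" using assms by (auto simp: a_def b_def)
  fix t assume t: "max 1 (a / b + 1) \<le> t"
  then have t1: "1 \<le> t" and tb: "a < b * t"
    using b by (auto simp: field_simps)
  have "b * t ^ (4*N - \<nu>) \<le> b * (\<Sum>i\<in>{N+1..4*N}. real (i choose \<nu>) * t ^ (i - \<nu>))"
  proof (rule mult_left_mono)
    \<comment> \<open>the last summand alone suffices\<close>
    have "1 \<le> real (4*N choose \<nu>)" using assms by (simp add: Suc_le_eq)
    then have "t ^ (4*N - \<nu>) \<le> real (4*N choose \<nu>) * t ^ (4*N - \<nu>)"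
      using t1 by (simp add: mult_le_cancel_right1)
    also have "\<dots> \<le> (\<Sum>i\<in>{N+1..4*N}. real (i choose \<nu>) * t ^ (i - \<nu>))"
      using assms t1 by (intro member_le_sum) auto
    finally show "t ^ (4*N - \<nu>) \<le> \<dots>" .
  qed (use b in simp)
  moreover have "a * t ^ (N - \<nu>) < b * t ^ (4*N - \<nu>)"
  proof -
    have "a * t ^ (N - \<nu>) < (b * t) * t ^ (N - \<nu>)" using tb t1 by simp
    also have "\<dots> = b * t ^ Suc (N - \<nu>)" by simp
    also have "\<dots> \<le> b * t ^ (4*N - \<nu>)"
      using b t1 assms by (intro mult_left_mono power_increasing) auto
    finally show ?thesis .
  qed
  moreover have "0 \<le> \<beta> / (2 * real N) * (\<Sum>i\<in>{\<nu>..<N}. real (i choose \<nu>) * t ^ (i - \<nu>))"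
    using assms t1 by (intro mult_nonneg_nonneg sum_nonneg) auto
  ultimately show "level_poly N \<beta> \<nu> t < 0"
    unfolding level_poly_def a_def[symmetric] b_def[symmetric] by linarith
qed

lemma finite_level_roots:
  assumes "1 \<le> N" "0 < \<beta>" "\<nu> \<le> N"
  shows "finite (level_roots N \<beta> \<nu>)"
proof -
  obtain T where T: "\<And>t. T \<le> t \<Longrightarrow> level_poly N \<beta> \<nu> t < 0"
    using level_poly_eventually_neg[OF assms] by blast
  obtain p where p: "\<And>t. poly p t = level_poly N \<beta> \<nu> t"
    using level_poly_as_polynomial by blast
  have "p \<noteq> 0" using T[of T] p[of T] by auto
  from poly_roots_finite[OF this] show ?thesis
    by (rule finite_subset[rotated]) (auto simp: level_roots_def p)
qed

text \<open>
  A positive value would force another root further to the right. The argument does not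
  presuppose that there are roots, so an arbitrary value of \<open>Max\<close> on the empty set is harmless.
\<close>

lemma level_poly_nonpos_above_roots:
  assumes "1 \<le> N" "0 < \<beta>" "\<nu> \<le> N" "0 \<le> t" "t_upper N \<beta> \<nu> < t"
  shows "level_poly N \<beta> \<nu> t \<le> 0"
proof (rule ccontr)
  assume pos: "\<not> level_poly N \<beta> \<nu> t \<le> 0"
  obtain T where T: "\<And>t. T \<le> t \<Longrightarrow> level_poly N \<beta> \<nu> t < 0"
    using level_poly_eventually_neg[OF assms(1-3)] by blast
  have "\<exists>u\<ge>t. u \<le> max t T \<and> level_poly N \<beta> \<nu> u = 0"
    using pos T[of "max t T"] by (intro IVT2' continuous_on_level_poly) auto
  then obtain u where u: "t \<le> u" "level_poly N \<beta> \<nu> u = 0" by blast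
  then have "u \<in> level_roots N \<beta> \<nu>" using assms(4) by (simp add: level_roots_def)
  then have "u \<le> t_upper N \<beta> \<nu>"
    using finite_level_roots[OF assms(1-3)] by (simp add: t_upper_def)
  then show False using u(1) assms(5) by simp
qed

text \<open>
  For \<open>\<nu> < N\<close> the only positive term vanishes at \<open>0\<close>, so the polynomial starts out nonpositive
  and a positive value would force a root before it. For \<open>\<nu> = N\<close> the lower root is \<open>0\<close> by convention and
  no \<open>t \<ge> 0\<close> lies below it.
\<close>

lemma level_poly_nonpos_below_roots:
  assumes "1 \<le> N" "0 < \<beta>" "\<nu> \<le> N" "0 \<le> t" "t < t_lower N \<beta> \<nu>"
  shows "level_poly N \<beta> \<nu> t \<le> 0"
proof (rule ccontr)
  assume pos: "\<not> level_poly N \<beta> \<nu> t \<le> 0"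
  have \<nu>: "\<nu> < N" using assms by (cases "\<nu> = N") (auto simp: t_lower_def)
  have "0 \<le> \<beta> / c * (\<Sum>i\<in>K. real (i choose \<nu>) * 0 ^ (i - \<nu>))" if "0 \<le> c" for c K
    using assms(2) that by (intro mult_nonneg_nonneg sum_nonneg) auto
  from this[of "2 * real N" "{\<nu>..<N}"] this[of "6 * real N" "{N+1..4*N}"]
  have "level_poly N \<beta> \<nu> 0 \<le> real (N choose \<nu>) * 0 ^ (N - \<nu>)"
    unfolding level_poly_def by linarith
  also have "\<dots> = 0" using \<nu> by simp
  finally have "level_poly N \<beta> \<nu> 0 \<le> 0" .
  then have "\<exists>u\<ge>0. u \<le> t \<and> level_poly N \<beta> \<nu> u = 0"
    using pos assms(4) by (intro IVT' continuous_on_level_poly) auto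
  then obtain u where u: "0 \<le> u" "u \<le> t" "level_poly N \<beta> \<nu> u = 0" by blast
  then have "u \<in> level_roots N \<beta> \<nu>" by (simp add: level_roots_def)
  then have "t_lower N \<beta> \<nu> \<le> u"
    using finite_level_roots[OF assms(1-3)] \<nu> by (simp add: t_lower_def)
  then show False using u(2) assms(5) by simp
qed

text \<open>
  Multiplication with \<open>t ^ (k - N)\<close> gives every term the factor \<open>t ^ (m - N)\<close>, the same for
  all complexities \<open>k\<close>. In this form the polynomial is the slack of a dual constraint.
\<close>

lemma level_poly_scaled:
  assumes "0 < t" "k \<le> N"
  shows "level_poly N \<beta> k t * (t ^ k / t ^ N) =
     real (N choose k) - \<beta> / (2 * real N) * (\<Sum>m<N. real (m choose k) * (t ^ m / t ^ N))
       - \<beta> / (6 * real N) * (\<Sum>m\<in>{N+1..4*N}. real (m choose k) * (t ^ m / t ^ N))"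
proof -
  have pw: "t ^ (m - k) * (t ^ k / t ^ N) = t ^ m / t ^ N" if "k \<le> m" for m
    using that assms(1) by (simp add: power_add[symmetric])
  have "(\<Sum>i\<in>{k..<N}. real (i choose k) * t ^ (i - k)) * (t ^ k / t ^ N)
      = (\<Sum>i\<in>{k..<N}. real (i choose k) * (t ^ i / t ^ N))"
    unfolding sum_distrib_right by (rule sum.cong) (simp_all add: pw mult.assoc del: times_divide_eq_right)
  also have "\<dots> = (\<Sum>m<N. real (m choose k) * (t ^ m / t ^ N))"
    by (rule sum.mono_neutral_left) (auto simp: binomial_eq_0)
  finally have 1: "(\<Sum>i\<in>{k..<N}. real (i choose k) * t ^ (i - k)) * (t ^ k / t ^ N) = \<dots>" .
  have 2: "(\<Sum>i\<in>{N+1..4*N}. real (i choose k) * t ^ (i - k)) * (t ^ k / t ^ N)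
      = (\<Sum>i\<in>{N+1..4*N}. real (i choose k) * (t ^ i / t ^ N))"
    unfolding sum_distrib_right using assms(2)
    by (intro sum.cong) (simp_all add: pw mult.assoc del: times_divide_eq_right)
  have 3: "t ^ (N - k) * (t ^ k / t ^ N) = 1" using pw[OF assms(2)] assms(1) by simp
  show ?thesis
    unfolding level_poly_def left_diff_distrib mult.assoc 1 2 3 by simp
qed

section \<open>Permutations and subsets of sample indices\<close>

text \<open>Index sets are kept in the form \<open>{1..m}\<close>, not \<open>{Suc 0..m}\<close>.\<close>

declare One_nat_def [simp del]

lemma ex_permutation_onto:
  assumes "I \<subseteq> {1..m}"
  obtains f where "bij_betw f {1..m} {1..m}" "f ` {1..card I} = I"
proof -
  have fin: "finite I" using assms finite_subset by blast
  have le: "card I \<le> m" using card_mono[OF _ assms] by simp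
  obtain f1 where f1: "bij_betw f1 {1..card I} I"
    using finite_same_card_bij[of "{1..card I}" I] fin by auto
  have "card ({1..m} - {1..card I}) = card ({1..m} - I)"
    using le by (simp add: card_Diff_subset fin assms)
  then obtain f2 where f2: "bij_betw f2 ({1..m} - {1..card I}) ({1..m} - I)"
    using finite_same_card_bij[of "{1..m} - {1..card I}" "{1..m} - I"] by auto
  \<comment> \<open>map \<open>{1..card I}\<close> to \<open>I\<close> and its complement to the complement of \<open>I\<close>\<close>
  let ?f = "\<lambda>x. if x \<in> {1..card I} then f1 x else f2 x"
  have "bij_betw ?f ({1..card I} \<union> ({1..m} - {1..card I})) (I \<union> ({1..m} - I))"
    by (rule bij_betw_disjoint_Un[OF f1 f2]) auto
  moreover have "{1..card I} \<union> ({1..m} - {1..card I}) = {1..m}" using le by auto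
  moreover have "I \<union> ({1..m} - I) = {1..m}" using assms by auto
  ultimately have "bij_betw ?f {1..m} {1..m}" by simp
  moreover have "?f ` {1..card I} = I" using f1 by (simp add: bij_betw_def)
  ultimately show ?thesis using that by blast
qed

lemma ennreal_inverse_mult_le_1: "inverse (ennreal p) * ennreal p \<le> 1"
proof (cases "p > 0")
  case True
  then show ?thesis
    using ennreal_divide_self[of "ennreal p"] by (simp add: divide_ennreal_def mult.commute)
qed (simp add: ennreal_neg)

lemma sum_over_subsets_by_card:
  fixes h :: "nat \<Rightarrow> ennreal"
  assumes "finite A"
  shows "(\<Sum>I | I \<subseteq> A \<and> card I \<le> n. h (card I)) = (\<Sum>k\<le>n. of_nat (card A choose k) * h k)"
proof -
  have "(\<Sum>I | I \<subseteq> A \<and> card I \<le> n. h (card I))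
      = (\<Sum>k\<le>n. \<Sum>I | I \<in> {I. I \<subseteq> A \<and> card I \<le> n} \<and> card I = k. h (card I))"
    by (rule sum.group[symmetric]) (use assms in auto)
  also have "\<dots> = (\<Sum>k\<le>n. of_nat (card A choose k) * h k)"
  proof (rule sum.cong[OF refl])
    fix k assume "k \<in> {..n}"
    then have "{I. I \<in> {I. I \<subseteq> A \<and> card I \<le> n} \<and> card I = k} = {I. I \<subseteq> A \<and> card I = k}" by auto
    then show "(\<Sum>I | I \<in> {I. I \<subseteq> A \<and> card I \<le> n} \<and> card I = k. h (card I)) = of_nat (card A choose k) * h k"
      using n_subsets[OF assms] by simp
  qed
  finally show ?thesis .
qed

section \<open>Decisions unaffected by noncritical samples\<close>

text \<open>
  This is \<open>(1 - v) ^ (m - N)\<close> with an integer exponent. The values are extended reals so that for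
  \<open>m < N\<close> the weight is infinite at \<open>v = 1\<close>: the bound on the integral of the weight then
  shows by itself that decisions of risk \<open>1\<close> with fewer than \<open>N\<close> critical samples do not
  occur.
\<close>

definition sample_weight :: "nat \<Rightarrow> nat \<Rightarrow> real \<Rightarrow> ennreal" where
  "sample_weight N m v =
     (if N \<le> m then ennreal ((1 - v) ^ (m - N)) else inverse (ennreal ((1 - v) ^ (N - m))))"

text \<open>
  The predicate \<open>decision I \<omega> \<theta>\<close> is read as: \<open>\<theta>\<close> is the unique solution for the samples
  \<open>\<omega> i\<close> with \<open>i \<in> I\<close>. It is a relation because only the problem with \<open>N\<close> samples is known
  to have a solution, and only its solution \<open>sol\<close> is known to be measurable. Everything about
  other sample sizes is therefore expressed through \<open>sol\<close>.
\<close>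

locale consistent_decision = prob_space P for P :: "'x measure" +
  fixes L :: "'b measure"
    and critical :: "'x \<Rightarrow> 'b \<Rightarrow> bool"
    and decision :: "nat set \<Rightarrow> (nat \<Rightarrow> 'x) \<Rightarrow> 'b \<Rightarrow> bool"
    and N :: nat
    and sol :: "(nat \<Rightarrow> 'x) \<Rightarrow> 'b"
  assumes pred_critical: "Measurable.pred (P \<Otimes>\<^sub>M L) (\<lambda>(x, \<theta>). critical x \<theta>)"
    and measurable_sol: "sol \<in> measurable (PiM {1..N} (\<lambda>_. P)) L"
    and decision_sol: "\<omega> \<in> space (PiM {1..N} (\<lambda>_. P)) \<Longrightarrow> decision {1..N} \<omega> (sol \<omega>)"
    and decision_unique: "decision I \<omega> \<theta> \<Longrightarrow> decision I \<omega> \<theta>' \<Longrightarrow> \<theta>' = \<theta>"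
    and decision_noncritical:
      "finite J \<Longrightarrow> I \<subseteq> J \<Longrightarrow> (\<And>j. j \<in> J \<Longrightarrow> \<omega> j \<in> space P) \<Longrightarrow>
       (\<And>j. j \<in> J - I \<Longrightarrow> \<not> critical (\<omega> j) \<theta>) \<Longrightarrow> decision I \<omega> \<theta> \<longleftrightarrow> decision J \<omega> \<theta>"
    and decision_reindex:
      "inj_on h I \<Longrightarrow> (\<And>i. i \<in> I \<Longrightarrow> \<omega>' i = \<omega> (h i)) \<Longrightarrow>
       decision I \<omega>' \<theta> \<longleftrightarrow> decision (h ` I) \<omega> \<theta>"
begin

sublocale prod: product_sigma_finite "\<lambda>_::nat. P" ..

abbreviation samples :: "nat \<Rightarrow> (nat \<Rightarrow> 'x) measure" where
  "samples m \<equiv> PiM {1..m} (\<lambda>_. P)"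

definition risk :: "'b \<Rightarrow> real" where
  "risk \<theta> = measure P {x \<in> space P. critical x \<theta>}"

definition critical_indices :: "nat set \<Rightarrow> (nat \<Rightarrow> 'x) \<Rightarrow> 'b \<Rightarrow> nat set" where
  "critical_indices J \<omega> \<theta> = {j \<in> J. critical (\<omega> j) \<theta>}"

lemma samplesD: "\<omega> \<in> space (PiM J (\<lambda>_. P)) \<Longrightarrow> i \<in> J \<Longrightarrow> \<omega> i \<in> space P"
  by (auto simp: space_PiM)

lemma prob_space_samples: "prob_space (PiM J (\<lambda>_. P))"
  by (rule prob_space_PiM) (rule prob_space_axioms)

lemma decision_cong:
  "(\<And>i. i \<in> I \<Longrightarrow> \<omega>' i = \<omega> i) \<Longrightarrow> decision I \<omega>' \<theta> \<longleftrightarrow> decision I \<omega> \<theta>"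
  using decision_reindex[of id I \<omega>' \<omega>] by simp

lemma sol_in_space: "\<omega> \<in> space (samples N) \<Longrightarrow> sol \<omega> \<in> space L"
  using measurable_sol by (rule measurable_space)

lemma pred_criticalI[measurable (raw)]:
  assumes "f \<in> measurable M P" "h \<in> measurable M L"
  shows "Measurable.pred M (\<lambda>z. critical (f z) (h z))"
  using measurable_compose[OF measurable_Pair[OF assms] pred_critical] by simp

lemma sets_critical: "\<theta> \<in> space L \<Longrightarrow> {x \<in> space P. critical x \<theta>} \<in> sets P"
  using pred_criticalI[of "\<lambda>x. x" P "\<lambda>_. \<theta>"] by simp

lemma measurable_risk[measurable]: "risk \<in> borel_measurable L"
proof -
  have "Measurable.pred (L \<Otimes>\<^sub>M P) (\<lambda>z. critical (snd z) (fst z))"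
    by (rule pred_criticalI) auto
  then have "{z \<in> space (L \<Otimes>\<^sub>M P). critical (snd z) (fst z)} \<in> sets (L \<Otimes>\<^sub>M P)"
    by (simp add: pred_def)
  moreover have "{z \<in> space (L \<Otimes>\<^sub>M P). snd z \<in> {x \<in> space P. critical x (fst z)}}
      = {z \<in> space (L \<Otimes>\<^sub>M P). critical (snd z) (fst z)}"
    by (auto simp: space_pair_measure)
  ultimately have "(\<lambda>\<theta>. emeasure P {x \<in> space P. critical x \<theta>}) \<in> borel_measurable L"
    by (intro measurable_emeasure) auto
  then show ?thesis unfolding risk_def measure_def by measurable
qed

lemma risk_le_1: "risk \<theta> \<le> 1" by (simp add: risk_def)
lemma risk_nonneg: "0 \<le> risk \<theta>" by (simp add: risk_def)

lemma measurable_critical_indices: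
  assumes "finite J" "h \<in> measurable M L" "\<And>j. j \<in> J \<Longrightarrow> (\<lambda>z. f z j) \<in> measurable M P"
  shows "{z \<in> space M. critical_indices J (f z) (h z) = I} \<in> sets M"
proof -
  have "{z \<in> space M. critical_indices J (f z) (h z) = I}
     = {z \<in> space M. I \<subseteq> J \<and> (\<forall>j\<in>J. critical (f z j) (h z) = (j \<in> I))}"
    by (auto simp: critical_indices_def)
  also have "\<dots> \<in> sets M"
  proof -
    have *: "{z \<in> space M. critical (f z j) (h z) = (j \<in> I)} \<in> sets M" if "j \<in> J" for j
    proof -
      have "Measurable.pred M (\<lambda>z. critical (f z j) (h z))"
        by (rule pred_criticalI) (use assms that in auto)
      then show ?thesis by (auto simp: pred_def intro: pred_intros_logic)
    qed
    have "{z \<in> space M. \<forall>j\<in>J. critical (f z j) (h z) = (j \<in> I)} \<in> sets M"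
      using assms(1) * by (intro sets.sets_Collect_finite_All) auto
    then show ?thesis by (cases "I \<subseteq> J") auto
  qed
  finally show ?thesis .
qed

text \<open>
  For a fixed parameter the samples in \<open>J\<close> are critical independently of each other.
\<close>

lemma emeasure_none_critical:
  fixes J :: "nat set"
  assumes "\<theta> \<in> space L" "finite J"
  shows "emeasure (PiM J (\<lambda>_. P)) {z \<in> space (PiM J (\<lambda>_. P)). \<forall>j\<in>J. \<not> critical (z j) \<theta>}
       = ennreal ((1 - risk \<theta>) ^ card J)"
proof -
  let ?C = "{x \<in> space P. \<not> critical x \<theta>}"
  have C: "?C = space P - {x \<in> space P. critical x \<theta>}" by auto
  have sets: "?C \<in> sets P" unfolding C using sets_critical[OF assms(1)] by auto
  have pr: "emeasure P ?C = ennreal (1 - risk \<theta>)"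
    using prob_compl[OF sets_critical[OF assms(1)]]
    by (simp add: C emeasure_eq_measure risk_def)
  have "{z \<in> space (PiM J (\<lambda>_. P)). \<forall>j\<in>J. \<not> critical (z j) \<theta>} = PiE J (\<lambda>_. ?C)"
    by (auto simp: space_PiM PiE_iff extensional_def)
  then have "emeasure (PiM J (\<lambda>_. P)) {z \<in> space (PiM J (\<lambda>_. P)). \<forall>j\<in>J. \<not> critical (z j) \<theta>}
     = (\<Prod>j\<in>J. emeasure P ?C)"
    using prod.emeasure_PiM[OF assms(2), of "\<lambda>_. ?C"] sets by simp
  then show ?thesis using risk_le_1 by (simp add: pr ennreal_power)
qed

lemma measurable_reindex:
  assumes "bij_betw f {1..m} {1..m}"
  shows "(\<lambda>\<omega>. \<lambda>i\<in>{1..m}. \<omega> (f i)) \<in> measurable (samples m) (samples m)"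
  using bij_betw_apply[OF assms] by (intro measurable_restrict measurable_component_singleton)

lemma nn_integral_reindex:
  assumes f: "bij_betw f {1..m} {1..m}" and F: "F \<in> borel_measurable (samples m)"
  shows "(\<integral>\<^sup>+\<omega>. F (\<lambda>i\<in>{1..m}. \<omega> (f i)) \<partial>samples m) = (\<integral>\<^sup>+\<omega>. F \<omega> \<partial>samples m)"
proof -
  have "(\<integral>\<^sup>+\<omega>. F \<omega> \<partial>samples m)
     = (\<integral>\<^sup>+\<omega>. F \<omega> \<partial>distr (samples m) (samples m) (\<lambda>\<omega>. \<lambda>i\<in>{1..m}. \<omega> (f i)))"
  proof -
    have "f \<in> {1..m} \<rightarrow> {1..m}" using bij_betw_apply[OF f] by blast
    then have "distr (samples m) (samples m) (\<lambda>\<omega>. \<lambda>i\<in>{1..m}. \<omega> (f i)) = samples m"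
      using distr_PiM_reindex[of "{1..m}" "\<lambda>_. P" f "{1..m}"] bij_betw_imp_inj_on[OF f]
        prob_space_axioms by blast
    then show ?thesis by simp
  qed
  also have "\<dots> = (\<integral>\<^sup>+\<omega>. F (\<lambda>i\<in>{1..m}. \<omega> (f i)) \<partial>samples m)"
    using F by (intro nn_integral_distr measurable_reindex f) simp
  finally show ?thesis by simp
qed

lemma decision_permuted:
  assumes f: "bij_betw f {1..m} {1..m}"
  shows "decision {1..m} (\<lambda>i\<in>{1..m}. \<omega> (f i)) \<theta> \<longleftrightarrow> decision {1..m} \<omega> \<theta>"
  using decision_reindex[OF bij_betw_imp_inj_on[OF f], of "\<lambda>i\<in>{1..m}. \<omega> (f i)" \<omega> \<theta>]
    bij_betw_imp_surj_on[OF f] by simp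

lemma critical_indices_permuted:
  assumes f: "bij_betw f {1..m} {1..m}" and K: "K \<subseteq> {1..m}"
  shows "critical_indices {1..m} (\<lambda>i\<in>{1..m}. \<omega> (f i)) \<theta> = K \<longleftrightarrow>
         critical_indices {1..m} \<omega> \<theta> = f ` K"
proof -
  have "critical_indices {1..m} \<omega> \<theta> = f ` critical_indices {1..m} (\<lambda>i\<in>{1..m}. \<omega> (f i)) \<theta>"
  proof -
    have "critical_indices {1..m} \<omega> \<theta> = {j \<in> f ` {1..m}. critical (\<omega> j) \<theta>}"
      using bij_betw_imp_surj_on[OF f] by (simp add: critical_indices_def)
    also have "\<dots> = f ` {i \<in> {1..m}. critical (\<omega> (f i)) \<theta>}" by blast
    also have "{i \<in> {1..m}. critical (\<omega> (f i)) \<theta>}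
        = critical_indices {1..m} (\<lambda>i\<in>{1..m}. \<omega> (f i)) \<theta>"
      by (auto simp: critical_indices_def)
    finally show ?thesis .
  qed
  moreover have "f ` critical_indices {1..m} (\<lambda>i\<in>{1..m}. \<omega> (f i)) \<theta> = f ` K \<longleftrightarrow>
     critical_indices {1..m} (\<lambda>i\<in>{1..m}. \<omega> (f i)) \<theta> = K"
    by (rule inj_on_image_eq_iff[of f "{1..m}"]) (use bij_betw_imp_inj_on[OF f] K in \<open>auto simp: critical_indices_def\<close>)
  ultimately show ?thesis by simp
qed

section \<open>The constraint of each sample size\<close>

text \<open>
  The integral of \<open>w\<close> against the law of \<open>sol\<close> restricted to the event that \<open>I\<close> is the set of
  critical indices.
\<close>

definition critical_integral :: "nat set \<Rightarrow> ('b \<Rightarrow> ennreal) \<Rightarrow> ennreal" where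
  "critical_integral I w =
     (\<integral>\<^sup>+\<omega>. indicator {\<omega>. critical_indices {1..N} \<omega> (sol \<omega>) = I} \<omega> * w (sol \<omega>) \<partial>samples N)"

lemma measurable_critical_integrand:
  fixes w :: "'b \<Rightarrow> ennreal"
  assumes "w \<in> borel_measurable L"
  shows "(\<lambda>\<omega>. indicator {\<omega>. critical_indices {1..N} \<omega> (sol \<omega>) = I} \<omega> * w (sol \<omega>))
     \<in> borel_measurable (samples N)"
proof -
  have "{\<omega> \<in> space (samples N). critical_indices {1..N} \<omega> (sol \<omega>) = I} \<in> sets (samples N)"
    by (rule measurable_critical_indices) (auto intro: measurable_sol)
  then have "(indicator {\<omega>. critical_indices {1..N} \<omega> (sol \<omega>) = I} :: _ \<Rightarrow> ennreal) \<in> borel_measurable (samples N)"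
    unfolding borel_measurable_indicator_iff by (simp add: Int_def conj_commute)
  then show ?thesis
    using measurable_compose[OF measurable_sol assms] by measurable
qed

text \<open>
  Move \<open>I\<close> to \<open>{1..card I}\<close> by a permutation of the samples: their law is invariant, and so is
  the solution, as the decisions do not depend on the order of the samples.
\<close>

lemma critical_integral_exchangeable:
  assumes I: "I \<subseteq> {1..N}" and w: "w \<in> borel_measurable L"
  shows "critical_integral I w = critical_integral {1..card I} w"
proof -
  obtain f where f: "bij_betw f {1..N} {1..N}" "f ` {1..card I} = I"
    using ex_permutation_onto[OF I] by blast
  have le: "card I \<le> N" using card_mono[OF _ I] by simp
  let ?r = "\<lambda>\<omega>. \<lambda>i\<in>{1..N}. \<omega> (f i)"
  have "critical_integral {1..card I} w =
    (\<integral>\<^sup>+\<omega>. indicator {\<omega>. critical_indices {1..N} \<omega> (sol \<omega>) = {1..card I}} (?r \<omega>) * w (sol (?r \<omega>)) \<partial>samples N)"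
    unfolding critical_integral_def
    by (rule nn_integral_reindex[symmetric, OF f(1) measurable_critical_integrand[OF w]])
  also have "\<dots> = critical_integral I w"
    unfolding critical_integral_def
  proof (rule nn_integral_cong)
    fix \<omega> assume \<omega>: "\<omega> \<in> space (samples N)"
    have r: "?r \<omega> \<in> space (samples N)"
      using measurable_space[OF measurable_reindex[OF f(1)] \<omega>] .
    have s: "sol (?r \<omega>) = sol \<omega>"
      using decision_sol[OF r] decision_sol[OF \<omega>] decision_permuted[OF f(1)] decision_unique by blast
    have "critical_indices {1..N} (?r \<omega>) (sol \<omega>) = {1..card I} \<longleftrightarrow>
          critical_indices {1..N} \<omega> (sol \<omega>) = I"
      using critical_indices_permuted[OF f(1), of "{1..card I}" \<omega> "sol \<omega>"] le f(2) by auto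
    then show "indicator {\<omega>. critical_indices {1..N} \<omega> (sol \<omega>) = {1..card I}} (?r \<omega>) * w (sol (?r \<omega>))
      = indicator {\<omega>. critical_indices {1..N} \<omega> (sol \<omega>) = I} \<omega> * w (sol \<omega>)"
      unfolding s by (simp only: indicator_def mem_Collect_eq s)
  qed
  finally show ?thesis by simp
qed

lemma sum_critical_integral_subsets:
  assumes m: "m \<le> N" and w: "\<And>k. w k \<in> borel_measurable L"
  shows "(\<Sum>k\<le>m. of_nat (m choose k) * critical_integral {1..k} (w k))
    = (\<integral>\<^sup>+\<omega>. indicator {\<omega>. critical_indices {1..N} \<omega> (sol \<omega>) \<subseteq> {1..m}} \<omega>
               * w (card (critical_indices {1..N} \<omega> (sol \<omega>))) (sol \<omega>) \<partial>samples N)"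
proof -
  let ?S = "{I. I \<subseteq> {1..m} \<and> card I \<le> m}"
  let ?c = "\<lambda>\<omega>. critical_indices {1..N} \<omega> (sol \<omega>)"
  have S: "?S = Pow {1..m}" using card_mono[of "{1..m}"] by auto
  have "(\<Sum>k\<le>m. of_nat (m choose k) * critical_integral {1..k} (w k))
      = (\<Sum>I\<in>?S. critical_integral {1..card I} (w (card I)))"
    using sum_over_subsets_by_card[of "{1..m}" "\<lambda>k. critical_integral {1..k} (w k)" m] by simp
  also have "\<dots> = (\<Sum>I\<in>?S. critical_integral I (w (card I)))"
    using m w by (intro sum.cong refl critical_integral_exchangeable[symmetric]) fastforce+
  also have "\<dots> = (\<integral>\<^sup>+\<omega>. (\<Sum>I\<in>?S. indicator {\<omega>. ?c \<omega> = I} \<omega> * w (card I) (sol \<omega>)) \<partial>samples N)"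
    unfolding critical_integral_def
    by (rule nn_integral_sum[symmetric]) (rule measurable_critical_integrand[OF w])
  also have "\<dots> = (\<integral>\<^sup>+\<omega>. indicator {\<omega>. ?c \<omega> \<subseteq> {1..m}} \<omega> * w (card (?c \<omega>)) (sol \<omega>) \<partial>samples N)"
  proof (rule nn_integral_cong)
    fix \<omega>
    have "(\<Sum>I\<in>?S. indicator {\<omega>. ?c \<omega> = I} \<omega> * w (card I) (sol \<omega>))
       = (\<Sum>I\<in>?S. if ?c \<omega> = I then w (card I) (sol \<omega>) else 0)"
      by (intro sum.cong) (auto simp: indicator_def)
    also have "\<dots> = (if ?c \<omega> \<in> ?S then w (card (?c \<omega>)) (sol \<omega>) else 0)"
      by (simp add: S)
    finally show "(\<Sum>I\<in>?S. indicator {\<omega>. ?c \<omega> = I} \<omega> * w (card I) (sol \<omega>))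
       = indicator {\<omega>. ?c \<omega> \<subseteq> {1..m}} \<omega> * w (card (?c \<omega>)) (sol \<omega>)"
      unfolding S by (simp add: indicator_def)
  qed
  finally show ?thesis .
qed

lemma measurable_risk_weight: "(\<lambda>\<theta>. inverse (ennreal ((1 - risk \<theta>) ^ n))) \<in> borel_measurable L"
  by measurable

text \<open>
  The left hand side is the integral of the weight over the event that all critical indices are
  at most \<open>m\<close>. Fix the first \<open>m\<close> samples. On that event the remaining \<open>N - m\<close> samples are not
  critical, so the solution is a decision for the first \<open>m\<close> samples and hence does not vary with
  the others. They are noncritical for it with probability \<open>(1 - risk) ^ (N - m)\<close>, which the
  weight cancels.
\<close>

lemma few_samples_constraint:
  assumes m: "m \<le> N"
  shows "(\<Sum>k\<le>m. of_nat (m choose k) *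
     critical_integral {1..k} (\<lambda>\<theta>. inverse (ennreal ((1 - risk \<theta>) ^ (N - m))))) \<le> 1"
proof -
  let ?w = "\<lambda>\<theta>. inverse (ennreal ((1 - risk \<theta>) ^ (N - m)))"
  let ?J = "{m+1..N}"
  let ?M = "\<lambda>J. PiM J (\<lambda>_::nat. P)"
  let ?c = "\<lambda>\<omega>. critical_indices {1..N} \<omega> (sol \<omega>)"
  let ?F = "\<lambda>\<omega>. indicator {\<omega>. ?c \<omega> \<subseteq> {1..m}} \<omega> * ?w (sol \<omega>)"
  have un: "{1..N} = {1..m} \<union> ?J" using m by auto
  have card: "card ?J = N - m" by simp
  have F: "?F \<in> borel_measurable (?M ({1..m} \<union> ?J))"
  proof -
    have "(\<lambda>\<omega>. \<Sum>I\<in>Pow {1..m}. indicator {\<omega>. ?c \<omega> = I} \<omega> * ?w (sol \<omega>)) \<in> borel_measurable (samples N)"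
      by (intro borel_measurable_sum measurable_critical_integrand measurable_risk_weight)
    moreover have "(\<Sum>I\<in>Pow {1..m}. indicator {\<omega>. ?c \<omega> = I} \<omega> * ?w (sol \<omega>)) = ?F \<omega>" for \<omega>
    proof -
      have "(\<Sum>I\<in>Pow {1..m}. indicator {\<omega>. ?c \<omega> = I} \<omega> * ?w (sol \<omega>))
        = (\<Sum>I\<in>Pow {1..m}. if ?c \<omega> = I then ?w (sol \<omega>) else 0)"
        by (intro sum.cong) (auto simp: indicator_def)
      also have "\<dots> = (if ?c \<omega> \<in> Pow {1..m} then ?w (sol \<omega>) else 0)"
        by (rule sum.delta') simp
      finally show ?thesis by (simp add: indicator_def)
    qed
    ultimately show ?thesis by (simp add: un[symmetric])
  qed
  have inner: "(\<integral>\<^sup>+z. ?F (merge {1..m} ?J (x, z)) \<partial>?M ?J) \<le> 1" if x: "x \<in> space (?M {1..m})" for x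
  proof (cases "\<exists>z\<in>space (?M ?J). ?c (merge {1..m} ?J (x, z)) \<subseteq> {1..m}")
    case False
    then have "(\<integral>\<^sup>+z. ?F (merge {1..m} ?J (x, z)) \<partial>?M ?J) = (\<integral>\<^sup>+z. 0 \<partial>?M ?J)"
      by (intro nn_integral_cong) (auto simp: indicator_def)
    then show ?thesis by simp
  next
    case True
    have merge_space: "merge {1..m} ?J (x, z) \<in> space (samples N)" if "z \<in> space (?M ?J)" for z
      using x that unfolding un by (auto simp: space_PiM PiE_iff merge_def extensional_def)
    \<comment> \<open>on the event, the solution is a decision for the first \<open>m\<close> samples alone and none of the
      others is critical for it\<close>
    have dec: "decision {1..m} x (sol (merge {1..m} ?J (x, z)))"
         and crit: "\<And>j. j \<in> ?J \<Longrightarrow> \<not> critical (z j) (sol (merge {1..m} ?J (x, z)))"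
      if z: "z \<in> space (?M ?J)" and c: "?c (merge {1..m} ?J (x, z)) \<subseteq> {1..m}" for z
    proof -
      let ?\<omega> = "merge {1..m} ?J (x, z)"
      have nc: "\<not> critical (?\<omega> j) (sol ?\<omega>)" if "j \<in> {1..N} - {1..m}" for j
        using c that by (auto simp: critical_indices_def)
      have "decision {1..m} ?\<omega> (sol ?\<omega>)"
        using decision_noncritical[of "{1..N}" "{1..m}" ?\<omega> "sol ?\<omega>"] m nc
          decision_sol[OF merge_space[OF z]] samplesD[OF merge_space[OF z]] by auto
      then show "decision {1..m} x (sol ?\<omega>)"
        by (subst decision_cong[where \<omega> = ?\<omega>]) (auto simp: merge_def)
      show "\<not> critical (z j) (sol ?\<omega>)" if "j \<in> ?J" for j
        using nc[of j] that by (auto simp: merge_def)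
    qed
    obtain z0 where z0: "z0 \<in> space (?M ?J)" "?c (merge {1..m} ?J (x, z0)) \<subseteq> {1..m}"
      using True by blast
    \<comment> \<open>the solution common to all completions of \<open>x\<close> in the event\<close>
    define \<theta> where "\<theta> = sol (merge {1..m} ?J (x, z0))"
    have \<theta>: "\<theta> \<in> space L" unfolding \<theta>_def by (intro sol_in_space merge_space z0)
    let ?E = "{z \<in> space (?M ?J). \<forall>j\<in>?J. \<not> critical (z j) \<theta>}"
    have "{z \<in> space (?M ?J). critical_indices ?J z \<theta> = {}} \<in> sets (?M ?J)"
      using \<theta> by (intro measurable_critical_indices) auto
    moreover have "{z \<in> space (?M ?J). critical_indices ?J z \<theta> = {}} = ?E"
      by (auto simp: critical_indices_def)
    ultimately have E: "?E \<in> sets (?M ?J)" by simp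
    have "(\<integral>\<^sup>+z. ?F (merge {1..m} ?J (x, z)) \<partial>?M ?J) \<le> (\<integral>\<^sup>+z. ?w \<theta> * indicator ?E z \<partial>?M ?J)"
    proof (rule nn_integral_mono)
      fix z assume z: "z \<in> space (?M ?J)"
      show "?F (merge {1..m} ?J (x, z)) \<le> ?w \<theta> * indicator ?E z"
      proof (cases "?c (merge {1..m} ?J (x, z)) \<subseteq> {1..m}")
        case True
        have "sol (merge {1..m} ?J (x, z)) = \<theta>"
          unfolding \<theta>_def using decision_unique dec z True z0 by blast
        then show ?thesis using crit[OF z True] z by (simp add: indicator_def)
      qed simp
    qed
    also have "\<dots> = ?w \<theta> * emeasure (?M ?J) ?E"
      using E by (simp add: nn_integral_cmult_indicator)
    also have "\<dots> = ?w \<theta> * ennreal ((1 - risk \<theta>) ^ (N - m))"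
      using emeasure_none_critical[OF \<theta>, of ?J] by simp
    also have "\<dots> \<le> 1" by (rule ennreal_inverse_mult_le_1)
    finally show ?thesis .
  qed
  have "(\<Sum>k\<le>m. of_nat (m choose k) * critical_integral {1..k} ?w) = (\<integral>\<^sup>+\<omega>. ?F \<omega> \<partial>samples N)"
    by (rule sum_critical_integral_subsets[OF m measurable_risk_weight])
  also have "\<dots> = (\<integral>\<^sup>+x. (\<integral>\<^sup>+z. ?F (merge {1..m} ?J (x, z)) \<partial>?M ?J) \<partial>?M {1..m})"
    using prod.product_nn_integral_fold[of "{1..m}" ?J ?F] F by (simp add: un)
  also have "\<dots> \<le> (\<integral>\<^sup>+x. 1 \<partial>?M {1..m})"
    by (rule nn_integral_mono) (rule inner)
  also have "\<dots> = 1"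
    using prob_space.emeasure_space_1[OF prob_space_samples] by simp
  finally show ?thesis .
qed

text \<open>
  Given the first \<open>N\<close> samples, the extra \<open>m - N\<close> samples must be noncritical for the solution
  that the first \<open>N\<close> determine. This has conditional probability \<open>(1 - risk) ^ (m - N)\<close>.
\<close>

lemma many_samples_event:
  assumes m: "N \<le> m" and k: "k \<le> N"
  defines "E \<equiv> {\<omega> \<in> space (samples m).
      critical_indices {1..m} \<omega> (sol (restrict \<omega> {1..N})) = {1..k}}"
  shows "E \<in> sets (samples m)"
    and "emeasure (samples m) E = critical_integral {1..k} (\<lambda>\<theta>. ennreal ((1 - risk \<theta>) ^ (m - N)))"
proof -
  let ?M = "\<lambda>J. PiM J (\<lambda>_::nat. P)"
  let ?J = "{N+1..m}"
  have restr: "(\<lambda>\<omega>. restrict \<omega> {1..N}) \<in> measurable (samples m) (samples N)"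
    using m by (intro measurable_restrict_subset) auto
  show E: "E \<in> sets (samples m)"
    unfolding E_def by (rule measurable_critical_indices)
      (simp_all add: measurable_compose[OF restr measurable_sol])
  have un: "{1..m} = {1..N} \<union> ?J" using m by auto
  have sp: "merge {1..N} ?J (x, z) \<in> space (samples m)" "restrict (merge {1..N} ?J (x, z)) {1..N} = x"
    if x: "x \<in> space (?M {1..N})" and z: "z \<in> space (?M ?J)" for x z
  proof -
    show "merge {1..N} ?J (x, z) \<in> space (samples m)"
      unfolding un by (rule measurable_space[OF measurable_merge])
        (use x z in \<open>simp add: space_pair_measure\<close>)
    have "restrict (merge {1..N} ?J (x, z)) {1..N} = restrict x {1..N}"
      by (rule restrict_merge) auto
    also have "\<dots> = x" using x by (simp add: space_PiM)
    finally show "restrict (merge {1..N} ?J (x, z)) {1..N} = x" .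
  qed
  have "emeasure (samples m) E = (\<integral>\<^sup>+\<omega>. indicator E \<omega> \<partial>samples m)" using E by simp
  also have "\<dots> = (\<integral>\<^sup>+x. (\<integral>\<^sup>+z. indicator E (merge {1..N} ?J (x, z)) \<partial>?M ?J) \<partial>?M {1..N})"
    using prod.product_nn_integral_fold[of "{1..N}" ?J "indicator E"] E by (simp add: un)
  also have "\<dots> = critical_integral {1..k} (\<lambda>\<theta>. ennreal ((1 - risk \<theta>) ^ (m - N)))"
    unfolding critical_integral_def
  proof (rule nn_integral_cong)
    fix x assume x: "x \<in> space (?M {1..N})"
    let ?A = "{z \<in> space (?M ?J). \<forall>j\<in>?J. \<not> critical (z j) (sol x)}"
    have A: "?A \<in> sets (?M ?J)"
    proof -
      have "{z \<in> space (?M ?J). critical_indices ?J z (sol x) = {}} \<in> sets (?M ?J)"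
        using sol_in_space[OF x] by (intro measurable_critical_indices) auto
      moreover have "{z \<in> space (?M ?J). critical_indices ?J z (sol x) = {}} = ?A"
        by (auto simp: critical_indices_def)
      ultimately show ?thesis by simp
    qed
    have eq: "indicator E (merge {1..N} ?J (x, z)) =
       indicator {\<omega>. critical_indices {1..N} \<omega> (sol \<omega>) = {1..k}} x * (indicator ?A z :: ennreal)"
      if z: "z \<in> space (?M ?J)" for z
    proof -
      have "critical_indices {1..m} (merge {1..N} ?J (x, z)) (sol x)
        = critical_indices {1..N} x (sol x) \<union> critical_indices ?J z (sol x)"
        unfolding un by (auto simp: critical_indices_def merge_def)
      moreover have "critical_indices {1..N} x (sol x) \<subseteq> {1..N}" "critical_indices ?J z (sol x) \<subseteq> ?J"
        by (auto simp: critical_indices_def)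
      moreover have "{1..k} \<subseteq> {1..N}" "{1..N} \<inter> ?J = {}" using k by auto
      ultimately have "critical_indices {1..m} (merge {1..N} ?J (x, z)) (sol x) = {1..k} \<longleftrightarrow>
         critical_indices {1..N} x (sol x) = {1..k} \<and> critical_indices ?J z (sol x) = {}"
        by blast
      also have "critical_indices ?J z (sol x) = {} \<longleftrightarrow> z \<in> ?A"
        using z by (auto simp: critical_indices_def)
      finally show ?thesis using sp[OF x z] by (simp add: E_def indicator_def)
    qed
    have "(\<integral>\<^sup>+z. indicator E (merge {1..N} ?J (x, z)) \<partial>?M ?J)
      = (\<integral>\<^sup>+z. indicator {\<omega>. critical_indices {1..N} \<omega> (sol \<omega>) = {1..k}} x * indicator ?A z \<partial>?M ?J)"
      by (rule nn_integral_cong) (rule eq)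
    also have "\<dots> = indicator {\<omega>. critical_indices {1..N} \<omega> (sol \<omega>) = {1..k}} x * emeasure (?M ?J) ?A"
      using A by (simp add: nn_integral_cmult_indicator)
    also have "\<dots> = indicator {\<omega>. critical_indices {1..N} \<omega> (sol \<omega>) = {1..k}} x * ennreal ((1 - risk (sol x)) ^ (m - N))"
      using emeasure_none_critical[OF sol_in_space[OF x], of ?J] by simp
    finally show "(\<integral>\<^sup>+z. indicator E (merge {1..N} ?J (x, z)) \<partial>?M ?J) = \<dots>" .
  qed
  finally show "emeasure (samples m) E = critical_integral {1..k} (\<lambda>\<theta>. ennreal ((1 - risk \<theta>) ^ (m - N)))" .
qed

text \<open>
  For each index set \<open>I\<close> with at most \<open>N\<close> elements consider the event that \<open>I\<close> is the set of
  critical indices of the decision made from \<open>N\<close> of the \<open>m\<close> samples, chosen to include those in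
  \<open>I\<close>. The left hand side is the sum of the probabilities of these events. They are disjoint:
  adding noncritical samples makes each of these decisions the decision for all \<open>m\<close> samples,
  and that decision determines \<open>I\<close>.
\<close>

lemma many_samples_constraint:
  assumes m: "N \<le> m"
  shows "(\<Sum>k\<le>N. of_nat (m choose k) *
     critical_integral {1..k} (\<lambda>\<theta>. ennreal ((1 - risk \<theta>) ^ (m - N)))) \<le> 1"
proof -
  let ?S = "{I. I \<subseteq> {1..m} \<and> card I \<le> N}"
  let ?w = "\<lambda>\<theta>. ennreal ((1 - risk \<theta>) ^ (m - N))"
  have "\<forall>I\<in>?S. \<exists>f. bij_betw f {1..m} {1..m} \<and> f ` {1..card I} = I"
  proof
    fix I assume "I \<in> ?S"
    then have "I \<subseteq> {1..m}" by blast
    then obtain f where "bij_betw f {1..m} {1..m}" "f ` {1..card I} = I"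
      by (rule ex_permutation_onto)
    then show "\<exists>f. bij_betw f {1..m} {1..m} \<and> f ` {1..card I} = I" by blast
  qed
  then have "\<exists>f. \<forall>I\<in>?S. bij_betw (f I) {1..m} {1..m} \<and> f I ` {1..card I} = I"
    by (rule bchoice)
  then obtain f where "\<forall>I\<in>?S. bij_betw (f I) {1..m} {1..m} \<and> f I ` {1..card I} = I"
    by (rule exE)
  then have f: "bij_betw (f I) {1..m} {1..m}" "f I ` {1..card I} = I" if "I \<in> ?S" for I
    using that by simp_all
  define r where "r I \<omega> = (\<lambda>i\<in>{1..m}. \<omega> (f I i))" for I and \<omega> :: "nat \<Rightarrow> 'x"
  define E where "E k = {\<omega> \<in> space (samples m).
      critical_indices {1..m} \<omega> (sol (restrict \<omega> {1..N})) = {1..k}}" for k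
  \<comment> \<open>the decision is taken from the \<open>N\<close> samples that \<open>f I\<close> brings to the front\<close>
  define EI where "EI I = {\<omega> \<in> space (samples m). r I \<omega> \<in> E (card I)}" for I
  have r: "r I \<in> measurable (samples m) (samples m)" if "I \<in> ?S" for I
    unfolding r_def by (rule measurable_reindex[OF f(1)[OF that]])
  have sets_E: "E k \<in> sets (samples m)" if "k \<le> N" for k
    unfolding E_def by (rule many_samples_event(1)[OF m that])
  have sets_EI: "EI I \<in> sets (samples m)" if "I \<in> ?S" for I
  proof -
    have "r I -` E (card I) \<inter> space (samples m) \<in> sets (samples m)"
      by (rule measurable_sets[OF r[OF that] sets_E]) (use that in simp)
    also have "r I -` E (card I) \<inter> space (samples m) = EI I" by (auto simp: EI_def)
    finally show ?thesis .
  qed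
  have em: "emeasure (samples m) (EI I) = critical_integral {1..card I} ?w" if I: "I \<in> ?S" for I
  proof -
    have "emeasure (samples m) (EI I) = (\<integral>\<^sup>+\<omega>. indicator (EI I) \<omega> \<partial>samples m)"
      using sets_EI[OF I] by simp
    also have "\<dots> = (\<integral>\<^sup>+\<omega>. indicator (E (card I)) (\<lambda>i\<in>{1..m}. \<omega> (f I i)) \<partial>samples m)"
      by (rule nn_integral_cong) (auto simp: EI_def r_def indicator_def)
    also have "\<dots> = (\<integral>\<^sup>+\<omega>. indicator (E (card I)) \<omega> \<partial>samples m)"
      using sets_E[of "card I"] I by (intro nn_integral_reindex f) auto
    also have "\<dots> = emeasure (samples m) (E (card I))"
      using sets_E[of "card I"] I by simp
    also have "\<dots> = critical_integral {1..card I} ?w"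
      unfolding E_def by (rule many_samples_event(2)[OF m]) (use I in auto)
    finally show ?thesis .
  qed
  \<comment> \<open>on \<open>EI I\<close>, the index set \<open>I\<close> can be read off from the decision for all \<open>m\<close> samples\<close>
  have key: "\<exists>\<theta>. decision {1..m} \<omega> \<theta> \<and> critical_indices {1..m} \<omega> \<theta> = I"
    if I: "I \<in> ?S" and \<omega>: "\<omega> \<in> EI I" for I \<omega>
  proof -
    let ?\<theta> = "sol (restrict (r I \<omega>) {1..N})"
    have rs: "r I \<omega> \<in> space (samples m)" and c: "critical_indices {1..m} (r I \<omega>) ?\<theta> = {1..card I}"
      using \<omega> by (auto simp: EI_def E_def)
    have "restrict (r I \<omega>) {1..N} \<in> space (samples N)"
      using samplesD[OF rs] m by (auto simp: space_PiM)
    then have "decision {1..N} (r I \<omega>) ?\<theta>"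
      using decision_sol decision_cong[of "{1..N}" "restrict (r I \<omega>) {1..N}" "r I \<omega>" ?\<theta>] by simp
    moreover have "\<not> critical (r I \<omega> j) ?\<theta>" if "j \<in> {1..m} - {1..N}" for j
    proof
      assume "critical (r I \<omega> j) ?\<theta>"
      then have "j \<in> critical_indices {1..m} (r I \<omega>) ?\<theta>"
        using that by (simp add: critical_indices_def)
      then show False unfolding c using that I by simp
    qed
    ultimately have "decision {1..m} (r I \<omega>) ?\<theta>"
      using decision_noncritical[of "{1..m}" "{1..N}" "r I \<omega>" ?\<theta>] m samplesD[OF rs] by auto
    then have "decision {1..m} \<omega> ?\<theta>"
      using decision_permuted[OF f(1)[OF I]] by (simp add: r_def)
    moreover have "{1..card I} \<subseteq> {1..m}" using I m by auto
    then have "critical_indices {1..m} \<omega> ?\<theta> = I"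
      using critical_indices_permuted[OF f(1)[OF I], of "{1..card I}" \<omega> ?\<theta>] c f(2)[OF I]
      by (simp add: r_def)
    ultimately show ?thesis by blast
  qed
  have disj: "disjoint_family_on EI ?S"
    unfolding disjoint_family_on_def
  proof (intro ballI impI)
    fix I I' assume II: "I \<in> ?S" "I' \<in> ?S" "I \<noteq> I'"
    have False if \<omega>: "\<omega> \<in> EI I" "\<omega> \<in> EI I'" for \<omega>
    proof -
      obtain \<theta> where \<theta>: "decision {1..m} \<omega> \<theta>" "critical_indices {1..m} \<omega> \<theta> = I"
        using key[OF II(1) \<omega>(1)] by (elim exE conjE)
      obtain \<theta>' where \<theta>': "decision {1..m} \<omega> \<theta>'" "critical_indices {1..m} \<omega> \<theta>' = I'"
        using key[OF II(2) \<omega>(2)] by (elim exE conjE)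
      have "\<theta>' = \<theta>" by (rule decision_unique[OF \<theta>(1) \<theta>'(1)])
      then show False using \<theta>(2) \<theta>'(2) II(3) by simp
    qed
    then show "EI I \<inter> EI I' = {}" by (intro equals0I) (elim IntE)
  qed
  have "(\<Sum>k\<le>N. of_nat (m choose k) * critical_integral {1..k} ?w)
      = (\<Sum>I\<in>?S. critical_integral {1..card I} ?w)"
    using sum_over_subsets_by_card[of "{1..m}" "\<lambda>k. critical_integral {1..k} ?w" N] by simp
  also have "\<dots> = (\<Sum>I\<in>?S. emeasure (samples m) (EI I))"
    by (rule sum.cong) (auto simp: em)
  also have "\<dots> = emeasure (samples m) (\<Union>I\<in>?S. EI I)"
    using sets_EI disj by (intro sum_emeasure) auto
  also have "\<dots> \<le> 1"
    using prob_space.measure_le_1[OF prob_space_samples] prob_space.emeasure_le_1[OF prob_space_samples] by blast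
  finally show ?thesis .
qed

lemma measurable_sample_weight: "(\<lambda>\<theta>. sample_weight N m (risk \<theta>)) \<in> borel_measurable L"
  unfolding sample_weight_def by measurable

lemma sample_constraint:
  "(\<Sum>k\<le>N. of_nat (m choose k) * critical_integral {1..k} (\<lambda>\<theta>. sample_weight N m (risk \<theta>))) \<le> 1"
proof (cases "N \<le> m")
  case True
  then have w: "sample_weight N m = (\<lambda>v. ennreal ((1 - v) ^ (m - N)))"
    by (intro ext) (simp only: sample_weight_def if_True)
  show ?thesis unfolding w by (rule many_samples_constraint[OF True])
next
  case False
  then have w: "sample_weight N m = (\<lambda>v. inverse (ennreal ((1 - v) ^ (N - m))))"
    by (intro ext) (simp only: sample_weight_def if_False)
  have m: "m \<le> N" using False by linarith
  have "(\<Sum>k\<le>N. of_nat (m choose k) * critical_integral {1..k} (\<lambda>\<theta>. sample_weight N m (risk \<theta>)))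
     = (\<Sum>k\<le>m. of_nat (m choose k) * critical_integral {1..k} (\<lambda>\<theta>. sample_weight N m (risk \<theta>)))"
  proof (rule sum.mono_neutral_right)
    show "\<forall>k\<in>{..N} - {..m}. of_nat (m choose k) *
        critical_integral {1..k} (\<lambda>\<theta>. sample_weight N m (risk \<theta>)) = 0"
      by (intro ballI) (simp only: binomial_eq_0 Diff_iff atMost_iff not_le of_nat_0 mult_zero_left)
  qed (use m in simp_all)
  also have "\<dots> \<le> 1" unfolding w by (rule few_samples_constraint[OF m])
  finally show ?thesis .
qed

lemma critical_integral_sum:
  assumes w: "\<And>m. m \<in> M \<Longrightarrow> w m \<in> borel_measurable L"
  shows "critical_integral I (\<lambda>\<theta>. \<Sum>m\<in>M. c m * w m \<theta>) = (\<Sum>m\<in>M. c m * critical_integral I (w m))"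
proof -
  define F where "F m \<omega> = indicator {\<omega>. critical_indices {1..N} \<omega> (sol \<omega>) = I} \<omega> * w m (sol \<omega>)" for m \<omega>
  have F: "F m \<in> borel_measurable (samples N)" if "m \<in> M" for m
    unfolding F_def[abs_def] by (rule measurable_critical_integrand[OF w[OF that]])
  have "critical_integral I (\<lambda>\<theta>. \<Sum>m\<in>M. c m * w m \<theta>) = (\<integral>\<^sup>+\<omega>. (\<Sum>m\<in>M. c m * F m \<omega>) \<partial>samples N)"
    unfolding critical_integral_def F_def
    by (intro nn_integral_cong) (subst sum_distrib_left, intro sum.cong refl mult.left_commute)
  also have "\<dots> = (\<Sum>m\<in>M. \<integral>\<^sup>+\<omega>. c m * F m \<omega> \<partial>samples N)"
    by (rule nn_integral_sum) (rule borel_measurable_times_ennreal[OF borel_measurable_const F])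
  also have "\<dots> = (\<Sum>m\<in>M. c m * (\<integral>\<^sup>+\<omega>. F m \<omega> \<partial>samples N))"
    by (rule sum.cong[OF refl nn_integral_cmult[OF F]])
  finally show ?thesis by (simp only: F_def critical_integral_def)
qed

section \<open>Weak duality\<close>

text \<open>
  Integrate the dual constraint at complexity \<open>k\<close> over the event of leaving the band with
  critical indices \<open>{1..k}\<close>, sum over \<open>k\<close>, exchange the sums over \<open>k\<close> and \<open>m\<close>, and apply
  the constraint of each sample size \<open>m\<close>.
\<close>

theorem risk_complexity_bound:
  fixes multiplier :: "nat \<Rightarrow> ennreal" and bad :: "nat \<Rightarrow> real set"
  assumes bad: "\<And>k. bad k \<in> sets borel"
    and dual: "\<And>k v. k \<le> N \<Longrightarrow> v \<in> bad k \<Longrightarrow> 0 \<le> v \<Longrightarrow> v \<le> 1 \<Longrightarrow>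
      of_nat (N choose k) \<le> (\<Sum>m\<in>M. multiplier m * of_nat (m choose k) * sample_weight N m v)"
  defines "B \<equiv> {\<omega> \<in> space (samples N).
      risk (sol \<omega>) \<in> bad (card (critical_indices {1..N} \<omega> (sol \<omega>)))}"
  shows "B \<in> sets (samples N)" and "emeasure (samples N) B \<le> (\<Sum>m\<in>M. multiplier m)"
proof -
  let ?c = "\<lambda>\<omega>. critical_indices {1..N} \<omega> (sol \<omega>)"
  let ?b = "\<lambda>k \<theta>. indicator (bad k) (risk \<theta>) :: ennreal"
  have c_sub: "?c \<omega> \<subseteq> {1..N}" for \<omega> by (auto simp: critical_indices_def)
  have b: "?b k \<in> borel_measurable L" for k
    by (rule measurable_compose[OF measurable_risk borel_measurable_indicator[OF bad]])
  have "B = (\<Union>I\<in>Pow {1..N}. {\<omega> \<in> space (samples N). ?c \<omega> = I} \<inter>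
              ((\<lambda>\<omega>. risk (sol \<omega>)) -` bad (card I) \<inter> space (samples N)))"
    using c_sub by (auto simp: B_def)
  also have "\<dots> \<in> sets (samples N)"
  proof (rule sets.finite_UN)
    fix I assume "I \<in> Pow {1..N}"
    have "{\<omega> \<in> space (samples N). ?c \<omega> = I} \<in> sets (samples N)"
      by (rule measurable_critical_indices) (simp_all add: measurable_sol)
    moreover have "(\<lambda>\<omega>. risk (sol \<omega>)) -` bad (card I) \<inter> space (samples N) \<in> sets (samples N)"
      using measurable_sets[OF measurable_compose[OF measurable_sol measurable_risk] bad] .
    ultimately show "{\<omega> \<in> space (samples N). ?c \<omega> = I} \<inter>
        ((\<lambda>\<omega>. risk (sol \<omega>)) -` bad (card I) \<inter> space (samples N)) \<in> sets (samples N)"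
      by (rule sets.Int)
  qed simp
  finally show B: "B \<in> sets (samples N)" .
  have "emeasure (samples N) B = (\<integral>\<^sup>+\<omega>. indicator B \<omega> \<partial>samples N)" using B by simp
  also have "\<dots> = (\<integral>\<^sup>+\<omega>. indicator {\<omega>. ?c \<omega> \<subseteq> {1..N}} \<omega> * ?b (card (?c \<omega>)) (sol \<omega>) \<partial>samples N)"
    using c_sub by (intro nn_integral_cong) (simp add: B_def indicator_def)
  also have "\<dots> = (\<Sum>k\<le>N. of_nat (N choose k) * critical_integral {1..k} (?b k))"
    by (rule sum_critical_integral_subsets[symmetric]) (simp_all add: b)
  also have "\<dots> \<le> (\<Sum>k\<le>N. critical_integral {1..k}
      (\<lambda>\<theta>. \<Sum>m\<in>M. (multiplier m * of_nat (m choose k)) * sample_weight N m (risk \<theta>)))"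
  proof (rule sum_mono)
    fix k assume k: "k \<in> {..N}"
    \<comment> \<open>the scalar moves inside as a sum over a single index\<close>
    have "of_nat (N choose k) * critical_integral {1..k} (?b k)
        = critical_integral {1..k} (\<lambda>\<theta>. \<Sum>m\<in>{0::nat}. of_nat (N choose k) * ?b k \<theta>)"
      by (subst critical_integral_sum[where c = "\<lambda>_. of_nat (N choose k)" and w = "\<lambda>_. ?b k"])
        (simp_all add: b)
    also have "\<dots> \<le> critical_integral {1..k}
      (\<lambda>\<theta>. \<Sum>m\<in>M. (multiplier m * of_nat (m choose k)) * sample_weight N m (risk \<theta>))"
      unfolding critical_integral_def
    proof (intro nn_integral_mono mult_left_mono)
      fix \<omega>
      show "(\<Sum>m\<in>{0::nat}. of_nat (N choose k) * ?b k (sol \<omega>)) \<le>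
         (\<Sum>m\<in>M. (multiplier m * of_nat (m choose k)) * sample_weight N m (risk (sol \<omega>)))"
        using dual[of k "risk (sol \<omega>)"] k risk_nonneg risk_le_1
        by (cases "risk (sol \<omega>) \<in> bad k") simp_all
    qed simp
    finally show "of_nat (N choose k) * critical_integral {1..k} (?b k) \<le> \<dots>" .
  qed
  also have "\<dots> = (\<Sum>k\<le>N. \<Sum>m\<in>M. (multiplier m * of_nat (m choose k)) *
      critical_integral {1..k} (\<lambda>\<theta>. sample_weight N m (risk \<theta>)))"
    by (intro sum.cong refl critical_integral_sum measurable_sample_weight)
  also have "\<dots> = (\<Sum>m\<in>M. multiplier m * (\<Sum>k\<le>N. of_nat (m choose k) *
      critical_integral {1..k} (\<lambda>\<theta>. sample_weight N m (risk \<theta>))))"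
    by (subst sum.swap) (simp add: sum_distrib_left mult.assoc)
  also have "\<dots> \<le> (\<Sum>m\<in>M. multiplier m * 1)"
    by (intro sum_mono mult_left_mono sample_constraint) simp
  finally show "emeasure (samples N) B \<le> (\<Sum>m\<in>M. multiplier m)" by simp
qed

end

section \<open>Dual multipliers for the level polynomials\<close>

definition multiplier :: "nat \<Rightarrow> real \<Rightarrow> nat \<Rightarrow> ennreal" where
  "multiplier N \<beta> m = ennreal (if m < N then \<beta> / (2 * real N) else \<beta> / (6 * real N))"

definition dual_sizes :: "nat \<Rightarrow> nat set" where
  "dual_sizes N = {..<N} \<union> {N+1..4*N}"

lemma sum_multiplier:
  assumes "1 \<le> N" "0 < \<beta>"
  shows "(\<Sum>m\<in>dual_sizes N. multiplier N \<beta> m) = ennreal \<beta>"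
proof -
  have "(\<Sum>m\<in>dual_sizes N. multiplier N \<beta> m)
     = ennreal (\<Sum>m\<in>dual_sizes N. if m < N then \<beta> / (2 * real N) else \<beta> / (6 * real N))"
    unfolding multiplier_def using assms by (intro sum_ennreal) auto
  also have "(\<Sum>m\<in>dual_sizes N. if m < N then \<beta> / (2 * real N) else \<beta> / (6 * real N))
     = (\<Sum>m<N. \<beta> / (2 * real N)) + (\<Sum>m\<in>{N+1..4*N}. \<beta> / (6 * real N))"
    unfolding dual_sizes_def
    by (subst sum.union_disjoint) (auto intro!: arg_cong2[where f = "(+)"] sum.cong)
  also have "\<dots> = \<beta>" using assms by (simp add: field_simps)
  finally show ?thesis .
qed

lemma sample_weight_eq_power_quotient:
  assumes "v < 1"
  shows "sample_weight N m v = ennreal ((1 - v) ^ m / (1 - v) ^ N)"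
proof (cases "N \<le> m")
  case True
  then show ?thesis using assms by (simp add: sample_weight_def power_diff)
next
  case False
  then have "(1 - v) ^ m / (1 - v) ^ N = inverse ((1 - v) ^ (N - m))"
    using assms by (simp add: power_diff field_simps)
  then show ?thesis using False assms by (simp add: sample_weight_def inverse_ennreal)
qed

text \<open>
  For \<open>v < 1\<close> this is \<open>level_poly_scaled\<close> at \<open>t = 1 - v\<close>. At \<open>v = 1\<close> the polynomial must
  not be scaled. There the hypothesis excludes \<open>k = N\<close>, where the level polynomial has value
  \<open>1\<close>, and for \<open>k < N\<close> the term \<open>m = k\<close> of the sum is infinite.
\<close>

lemma multiplier_dual_feasible:
  assumes N: "1 \<le> N" and \<beta>: "0 < \<beta>" and k: "k \<le> N" and v: "v \<le> 1"
    and le: "level_poly N \<beta> k (1 - v) \<le> 0"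
  shows "of_nat (N choose k) \<le>
    (\<Sum>m\<in>dual_sizes N. multiplier N \<beta> m * of_nat (m choose k) * sample_weight N m v)"
proof (cases "v = 1")
  case False
  define t where "t = 1 - v"
  have t: "0 < t" "v < 1" using v False by (auto simp: t_def)
  let ?l = "\<lambda>m. if m < N then \<beta> / (2 * real N) else \<beta> / (6 * real N)"
  have "level_poly N \<beta> k t * (t ^ k / t ^ N) \<le> 0"
    using le t by (intro mult_nonpos_nonneg) (auto simp: t_def)
  then have "real (N choose k) \<le> \<beta> / (2 * real N) * (\<Sum>m<N. real (m choose k) * (t ^ m / t ^ N))
       + \<beta> / (6 * real N) * (\<Sum>m\<in>{N+1..4*N}. real (m choose k) * (t ^ m / t ^ N))"
    unfolding level_poly_scaled[OF t(1) k] by linarith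
  also have "\<dots> = (\<Sum>m\<in>dual_sizes N. ?l m * real (m choose k) * (t ^ m / t ^ N))"
  proof -
    have "(\<Sum>m\<in>dual_sizes N. ?l m * real (m choose k) * (t ^ m / t ^ N))
       = (\<Sum>m<N. ?l m * real (m choose k) * (t ^ m / t ^ N))
         + (\<Sum>m\<in>{N+1..4*N}. ?l m * real (m choose k) * (t ^ m / t ^ N))"
      unfolding dual_sizes_def by (rule sum.union_disjoint) auto
    also have "(\<Sum>m<N. ?l m * real (m choose k) * (t ^ m / t ^ N))
       = \<beta> / (2 * real N) * (\<Sum>m<N. real (m choose k) * (t ^ m / t ^ N))"
      unfolding sum_distrib_left by (rule sum.cong) auto
    also have "(\<Sum>m\<in>{N+1..4*N}. ?l m * real (m choose k) * (t ^ m / t ^ N))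
       = \<beta> / (6 * real N) * (\<Sum>m\<in>{N+1..4*N}. real (m choose k) * (t ^ m / t ^ N))"
      unfolding sum_distrib_left by (rule sum.cong) auto
    finally show ?thesis by simp
  qed
  finally have "ennreal (real (N choose k)) \<le> ennreal \<dots>" by (rule ennreal_leI)
  also have "ennreal (\<Sum>m\<in>dual_sizes N. ?l m * real (m choose k) * (t ^ m / t ^ N))
     = (\<Sum>m\<in>dual_sizes N. ennreal (?l m * real (m choose k) * (t ^ m / t ^ N)))"
    using \<beta> t by (intro sum_ennreal[symmetric]) auto
  also have "\<dots> = (\<Sum>m\<in>dual_sizes N. multiplier N \<beta> m * of_nat (m choose k) * sample_weight N m v)"
  proof (rule sum.cong[OF refl])
    fix m
    have "0 \<le> ?l m" "0 \<le> t ^ m / t ^ N" using \<beta> t by auto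
    then show "ennreal (?l m * real (m choose k) * (t ^ m / t ^ N))
      = multiplier N \<beta> m * of_nat (m choose k) * sample_weight N m v"
      unfolding multiplier_def sample_weight_eq_power_quotient[OF t(2)] t_def[symmetric]
        ennreal_of_nat_eq_real_of_nat
      by (simp only: ennreal_mult mult_nonneg_nonneg of_nat_0_le_iff)
  qed
  finally show ?thesis by (simp only: ennreal_of_nat_eq_real_of_nat)
next
  case True
  have "k < N"
  proof (rule ccontr)
    assume "\<not> k < N"
    then have "k = N" using k by simp
    moreover have "(\<Sum>i\<in>{N+1..4*N}. real (i choose N) * 0 ^ (i - N)) = 0"
      by (rule sum.neutral) auto
    ultimately show False using le True by (simp add: level_poly_def)
  qed
  have "top = multiplier N \<beta> k * of_nat (k choose k) * sample_weight N k v"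
  proof -
    have "sample_weight N k v = top"
      using True \<open>k < N\<close> by (simp add: sample_weight_def zero_power)
    moreover have "multiplier N \<beta> k * of_nat (k choose k) \<noteq> 0"
      using \<open>k < N\<close> \<beta> by (simp add: multiplier_def)
    ultimately show ?thesis by (simp add: ennreal_mult_top)
  qed
  also have "\<dots> \<le> (\<Sum>m\<in>dual_sizes N. multiplier N \<beta> m * of_nat (m choose k) * sample_weight N m v)"
    using \<open>k < N\<close> by (intro member_le_sum) (auto simp: dual_sizes_def)
  finally show ?thesis by (simp add: top_unique)
qed

section \<open>Minimisers of penalised convex functions\<close>

definition unique_minimiser :: "'b set \<Rightarrow> ('b \<Rightarrow> real) \<Rightarrow> 'b \<Rightarrow> bool" where
  "unique_minimiser \<Theta> F \<theta> \<longleftrightarrow> \<theta> \<in> \<Theta> \<and> (\<forall>\<theta>'\<in>\<Theta>. F \<theta>' \<le> F \<theta> \<longrightarrow> \<theta>' = \<theta>)"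

text \<open>
  Penalties that vanish at \<open>\<theta>\<close> can be added, since the values elsewhere only grow. Conversely, let
  \<open>\<theta>'\<close> compete with \<open>\<theta>\<close> once they are removed. By convexity, points of the segment close to
  \<open>\<theta>\<close> are at least as good as \<open>\<theta>\<close>, and there the removed penalties still vanish. So these
  points also compete in the full problem, which forces \<open>\<theta>' = \<theta>\<close>.
\<close>

lemma unique_minimiser_inactive_penalties:
  fixes base :: "'b::real_vector \<Rightarrow> real" and c :: "'i \<Rightarrow> 'b \<Rightarrow> real"
  assumes J: "finite J" and I: "I \<subseteq> J" and a: "0 \<le> a"
    and convex_base: "convex_on \<Theta> base"
    and convex_c: "\<And>j. j \<in> J \<Longrightarrow> convex_on \<Theta> (c j)"
    and nonneg: "\<And>j \<theta>'. j \<in> J \<Longrightarrow> 0 \<le> c j \<theta>'"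
    and zero: "\<And>j. j \<in> J - I \<Longrightarrow> c j \<theta> = 0"
    and near: "\<And>j \<theta>'. j \<in> J - I \<Longrightarrow> \<theta> \<in> \<Theta> \<Longrightarrow> \<theta>' \<in> \<Theta> \<Longrightarrow>
      \<forall>\<^sub>F t in at_right 0. c j ((1 - t) *\<^sub>R \<theta> + t *\<^sub>R \<theta>') = 0"
  shows "unique_minimiser \<Theta> (\<lambda>\<theta>'. base \<theta>' + a * (\<Sum>j\<in>I. c j \<theta>')) \<theta> \<longleftrightarrow>
         unique_minimiser \<Theta> (\<lambda>\<theta>'. base \<theta>' + a * (\<Sum>j\<in>J. c j \<theta>')) \<theta>"
proof -
  define F where "F K \<theta>' = base \<theta>' + a * (\<Sum>j\<in>K. c j \<theta>')" for K \<theta>'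
  have mono: "F I \<theta>' \<le> F J \<theta>'" for \<theta>'
    unfolding F_def using J I a nonneg
    by (intro add_left_mono mult_left_mono sum_mono2) auto
  have eq: "F J \<theta>' = F I \<theta>'" if "\<And>j. j \<in> J - I \<Longrightarrow> c j \<theta>' = 0" for \<theta>'
    unfolding F_def using sum.mono_neutral_right[of J I "\<lambda>j. c j \<theta>'"] J I that by simp
  have "unique_minimiser \<Theta> (F I) \<theta> \<longleftrightarrow> unique_minimiser \<Theta> (F J) \<theta>"
  proof
    assume "unique_minimiser \<Theta> (F I) \<theta>"
    then show "unique_minimiser \<Theta> (F J) \<theta>"
      unfolding unique_minimiser_def using mono eq[OF zero] by (metis order_trans)
  next
    assume um: "unique_minimiser \<Theta> (F J) \<theta>"
    then have \<theta>: "\<theta> \<in> \<Theta>" by (simp add: unique_minimiser_def)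
    have "\<theta>' = \<theta>" if \<theta>': "\<theta>' \<in> \<Theta>" and le: "F I \<theta>' \<le> F I \<theta>" for \<theta>'
    proof -
      let ?p = "\<lambda>t. (1 - t) *\<^sub>R \<theta> + t *\<^sub>R \<theta>'"
      have "\<forall>\<^sub>F t in at_right 0. \<forall>j\<in>J - I. c j (?p t) = 0"
        using J near[OF _ \<theta> \<theta>'] by (intro eventually_ball_finite) auto
      moreover have "\<forall>\<^sub>F t in at_right (0::real). 0 < t \<and> t < 1"
        by (rule eventually_at_rightI[of 0 1]) auto
      ultimately have "\<forall>\<^sub>F t in at_right 0. (\<forall>j\<in>J - I. c j (?p t) = 0) \<and> 0 < t \<and> t < 1"
        by (rule eventually_conj)
      then obtain t where t: "\<And>j. j \<in> J - I \<Longrightarrow> c j (?p t) = 0" "0 < t" "t < 1"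
        using eventually_happens'[OF trivial_limit_at_right_real] by fastforce
      have "convex_on \<Theta> (\<lambda>\<theta>'. \<Sum>j\<in>I. c j \<theta>')"
        using finite_subset[OF I J] I
      proof induction
        case empty
        show ?case using convex_base by (simp add: convex_on_def)
      next
        case (insert j K)
        then show ?case using convex_on_add[of \<Theta> "c j" "\<lambda>\<theta>'. \<Sum>j\<in>K. c j \<theta>'"] convex_c by simp
      qed
      then have "convex_on \<Theta> (F I)"
        unfolding F_def[abs_def] by (intro convex_on_add convex_on_cmul convex_base a)
      then have "?p t \<in> \<Theta>" and "F I (?p t) \<le> (1 - t) * F I \<theta> + t * F I \<theta>'"
        using \<theta> \<theta>' t(2,3) by (auto simp: convex_on_def convex_alt)
      note this(2)
      also have "\<dots> \<le> (1 - t) * F I \<theta> + t * F I \<theta>"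
        using le t by (intro add_left_mono mult_left_mono) auto
      also have "\<dots> = F J \<theta>" using eq[OF zero] by (simp add: algebra_simps)
      finally have "F J (?p t) \<le> F J \<theta>" using eq[OF t(1)] by simp
      then have "?p t = \<theta>" using um \<open>?p t \<in> \<Theta>\<close> by (simp add: unique_minimiser_def)
      then have "t *\<^sub>R (\<theta>' - \<theta>) = 0" by (simp add: algebra_simps)
      then show "\<theta>' = \<theta>" using t(2) by simp
    qed
    then show "unique_minimiser \<Theta> (F I) \<theta>" using \<theta> by (simp add: unique_minimiser_def)
  qed
  then show ?thesis by (simp add: F_def[abs_def])
qed

section \<open>Elimination of the slack variables\<close>

text \<open>
  The least feasible slack of a sample whose polytope has the vertices \<open>V\<close>.
\<close>

definition least_slack ::
  "('t \<Rightarrow> real^'n \<Rightarrow> real^'p \<Rightarrow> real) \<Rightarrow> ('n,'t::finite) series set \<Rightarrow> ('p,'t) series \<Rightarrow> real" where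
  "least_slack g V \<theta> = Max (insert 0 ((\<lambda>v. gmax g v \<theta>) ` V))"

lemma least_slack_le_iff:
  "finite V \<Longrightarrow> least_slack g V \<theta> \<le> u \<longleftrightarrow> 0 \<le> u \<and> (\<forall>v\<in>V. gmax g v \<theta> \<le> u)"
  by (simp add: least_slack_def)

lemma least_slack_ge:
  "finite V \<Longrightarrow> 0 \<le> least_slack g V \<theta>"
  "finite V \<Longrightarrow> v \<in> V \<Longrightarrow> gmax g v \<theta> \<le> least_slack g V \<theta>"
  by (simp_all add: least_slack_def)

lemma least_slack_eq_0:
  "finite V \<Longrightarrow> (\<And>v. v \<in> V \<Longrightarrow> gmax g v \<theta> \<le> 0) \<Longrightarrow> least_slack g V \<theta> = 0"
  using least_slack_le_iff[of V g \<theta> 0] least_slack_ge(1)[of V g \<theta>] by fastforce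

lemma convex_on_least_slack:
  assumes V: "finite V" and convex: "convex \<Theta>" "\<And>v. v \<in> V \<Longrightarrow> convex_on \<Theta> (gmax g v)"
  shows "convex_on \<Theta> (least_slack g V)"
proof (rule convex_onI[OF _ convex(1)])
  fix t :: real and \<theta> \<theta>' assume t: "0 < t" "t < 1" and \<theta>: "\<theta> \<in> \<Theta>" "\<theta>' \<in> \<Theta>"
  let ?p = "(1 - t) *\<^sub>R \<theta> + t *\<^sub>R \<theta>'"
  let ?u = "(1 - t) * least_slack g V \<theta> + t * least_slack g V \<theta>'"
  have "gmax g v ?p \<le> ?u" if "v \<in> V" for v
  proof -
    have "gmax g v ?p \<le> (1 - t) * gmax g v \<theta> + t * gmax g v \<theta>'"
      using convex_onD[OF convex(2)[OF that], of t \<theta> \<theta>'] t \<theta> by simp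
    also have "\<dots> \<le> ?u"
      using least_slack_ge(2)[OF V that] t by (intro add_mono mult_left_mono) auto
    finally show ?thesis .
  qed
  then show "least_slack g V ?p \<le> ?u"
    using t least_slack_ge(1)[OF V, of g \<theta>] least_slack_ge(1)[OF V, of g \<theta>']
    by (simp add: least_slack_le_iff[OF V])
qed

text \<open>
  A convex function that is negative at \<open>\<theta>\<close> is negative along the beginning of any segment that
  starts at \<open>\<theta>\<close>. As there are finitely many vertices, one beginning serves them all.
\<close>

lemma least_slack_eq_0_nearby:
  assumes V: "finite V" and convex: "\<And>v. v \<in> V \<Longrightarrow> convex_on \<Theta> (gmax g v)"
    and neg: "\<And>v. v \<in> V \<Longrightarrow> gmax g v \<theta> < 0" and \<theta>: "\<theta> \<in> \<Theta>" "\<theta>' \<in> \<Theta>"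
  shows "\<forall>\<^sub>F t in at_right 0. least_slack g V ((1 - t) *\<^sub>R \<theta> + t *\<^sub>R \<theta>') = 0"
proof -
  have "\<forall>\<^sub>F t in at_right 0. gmax g v ((1 - t) *\<^sub>R \<theta> + t *\<^sub>R \<theta>') \<le> 0" if v: "v \<in> V" for v
  proof -
    have "((\<lambda>t. (1 - t) * gmax g v \<theta> + t * gmax g v \<theta>') \<longlongrightarrow> (1 - 0) * gmax g v \<theta> + 0 * gmax g v \<theta>')
        (at_right 0)"
      by (intro tendsto_intros)
    then have "\<forall>\<^sub>F t in at_right 0. (1 - t) * gmax g v \<theta> + t * gmax g v \<theta>' < 0"
      by (rule order_tendstoD(2)) (simp add: neg[OF v])
    moreover have "\<forall>\<^sub>F t in at_right (0::real). 0 < t \<and> t < 1"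
      by (rule eventually_at_rightI[of 0 1]) auto
    ultimately show ?thesis
    proof eventually_elim
      case (elim t)
      then show ?case using convex_onD[OF convex[OF v], of t \<theta> \<theta>'] \<theta> by simp
    qed
  qed
  then have "\<forall>\<^sub>F t in at_right 0. \<forall>v\<in>V. gmax g v ((1 - t) *\<^sub>R \<theta> + t *\<^sub>R \<theta>') \<le> 0"
    using V by (intro eventually_ball_finite) auto
  then show ?thesis
    by (rule eventually_mono) (auto intro: least_slack_eq_0[OF V])
qed

definition penalised_cost ::
  "('t \<Rightarrow> real^'n \<Rightarrow> real^'p \<Rightarrow> real) \<Rightarrow> ((real^'n) set \<Rightarrow> real) \<Rightarrow> real
    \<Rightarrow> (('n,'t::finite) series \<Rightarrow> ('n,'t) series set) \<Rightarrow> nat set \<Rightarrow> (nat \<Rightarrow> ('n,'t) series)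
    \<Rightarrow> ('p,'t) series \<Rightarrow> real" where
  "penalised_cost g S \<rho> Q I \<omega> \<theta> = (\<Sum>k\<in>UNIV. S (reach_set g k (\<theta> $ k)))
     + real CARD('t) * \<rho> * (\<Sum>i\<in>I. least_slack g (vertices (Q (\<omega> i))) \<theta>)"

text \<open>
  The cost does not decrease in the slacks, so the least feasible slacks are optimal for their
  parameter. The sum
  over the time steps repeats the penalty \<open>CARD('t)\<close> times.
\<close>

lemma optimal_iff_penalised_cost:
  fixes g :: "'t::finite \<Rightarrow> real^'n \<Rightarrow> real^'p \<Rightarrow> real"
  assumes \<rho>: "0 \<le> \<rho>" and fin: "\<And>i. i \<in> {1..N} \<Longrightarrow> finite (vertices (Q (\<omega> i)))"
  shows "optimal g S \<rho> \<Theta> Q N \<omega> \<theta> \<longleftrightarrow> \<theta> \<in> \<Theta> \<and>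
    (\<forall>\<theta>'\<in>\<Theta>. penalised_cost g S \<rho> Q {1..N} \<omega> \<theta> \<le> penalised_cost g S \<rho> Q {1..N} \<omega> \<theta>')"
proof -
  let ?J = "penalised_cost g S \<rho> Q {1..N} \<omega>"
  let ?\<xi> = "\<lambda>\<theta> i. least_slack g (vertices (Q (\<omega> i))) \<theta>"
  have cost: "cost g S \<rho> N \<theta> \<xi> = (\<Sum>k\<in>UNIV. S (reach_set g k (\<theta> $ k)))
     + real CARD('t) * \<rho> * (\<Sum>i\<in>{1..N}. \<xi> i)" for \<theta> \<xi>
    by (simp add: cost_def sum.distrib)
  have feas: "feasible g \<Theta> Q N \<omega> \<theta> (?\<xi> \<theta>)" "cost g S \<rho> N \<theta> (?\<xi> \<theta>) = ?J \<theta>" if "\<theta> \<in> \<Theta>" for \<theta>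
    using that fin by (auto simp: feasible_def cost penalised_cost_def least_slack_ge)
  have lower: "\<theta> \<in> \<Theta>" "?J \<theta> \<le> cost g S \<rho> N \<theta> \<xi>" if "feasible g \<Theta> Q N \<omega> \<theta> \<xi>" for \<theta> \<xi>
  proof -
    show "\<theta> \<in> \<Theta>" using that by (simp add: feasible_def)
    show "?J \<theta> \<le> cost g S \<rho> N \<theta> \<xi>"
      unfolding cost penalised_cost_def using that \<rho> fin
      by (intro add_left_mono mult_left_mono sum_mono) (auto simp: feasible_def least_slack_le_iff)
  qed
  show ?thesis
  proof
    assume "optimal g S \<rho> \<Theta> Q N \<omega> \<theta>"
    then obtain \<xi> where \<xi>: "feasible g \<Theta> Q N \<omega> \<theta> \<xi>"
      "\<And>\<theta>' \<xi>'. feasible g \<Theta> Q N \<omega> \<theta>' \<xi>' \<Longrightarrow> cost g S \<rho> N \<theta> \<xi> \<le> cost g S \<rho> N \<theta>' \<xi>'"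
      unfolding optimal_def by blast
    have "?J \<theta> \<le> ?J \<theta>'" if "\<theta>' \<in> \<Theta>" for \<theta>'
      using lower(2)[OF \<xi>(1)] \<xi>(2)[OF feas(1)[OF that]] feas(2)[OF that] by linarith
    then show "\<theta> \<in> \<Theta> \<and> (\<forall>\<theta>'\<in>\<Theta>. ?J \<theta> \<le> ?J \<theta>')" using lower(1)[OF \<xi>(1)] by blast
  next
    assume *: "\<theta> \<in> \<Theta> \<and> (\<forall>\<theta>'\<in>\<Theta>. ?J \<theta> \<le> ?J \<theta>')"
    show "optimal g S \<rho> \<Theta> Q N \<omega> \<theta>"
      unfolding optimal_def
    proof (intro exI conjI allI impI)
      show "feasible g \<Theta> Q N \<omega> \<theta> (?\<xi> \<theta>)" using feas(1) * by blast
      fix \<theta>' \<xi>' assume f: "feasible g \<Theta> Q N \<omega> \<theta>' \<xi>'"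
      show "cost g S \<rho> N \<theta> (?\<xi> \<theta>) \<le> cost g S \<rho> N \<theta>' \<xi>'"
        using lower[OF f] * feas(2) by fastforce
    qed
  qed
qed

lemma opt_param_unique_minimiser:
  assumes "0 \<le> \<rho>" "\<And>i. i \<in> {1..N} \<Longrightarrow> finite (vertices (Q (\<omega> i)))"
    and "\<exists>!\<theta>. optimal g S \<rho> \<Theta> Q N \<omega> \<theta>"
  shows "unique_minimiser \<Theta> (penalised_cost g S \<rho> Q {1..N} \<omega>) (opt_param g S \<rho> \<Theta> Q N \<omega>)"
proof -
  have opt: "optimal g S \<rho> \<Theta> Q N \<omega> (opt_param g S \<rho> \<Theta> Q N \<omega>)"
    unfolding opt_param_def using assms(3) by (rule theI')
  note iff = optimal_iff_penalised_cost[of \<rho> N Q \<omega> g S \<Theta>, OF assms(1,2)]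
  show ?thesis
    unfolding unique_minimiser_def
  proof (intro conjI ballI impI)
    show "opt_param g S \<rho> \<Theta> Q N \<omega> \<in> \<Theta>" using opt iff by blast
    fix \<theta>' assume "\<theta>' \<in> \<Theta>" and "penalised_cost g S \<rho> Q {1..N} \<omega> \<theta>' \<le>
       penalised_cost g S \<rho> Q {1..N} \<omega> (opt_param g S \<rho> \<Theta> Q N \<omega>)"
    then have "optimal g S \<rho> \<Theta> Q N \<omega> \<theta>'" using opt iff by (meson order_trans)
    then show "\<theta>' = opt_param g S \<rho> \<Theta> Q N \<omega>" using assms(3) opt by blast
  qed
qed

lemma gmax_le_iff: "gmax g x \<theta> \<le> u \<longleftrightarrow> (\<forall>k. g k (x $ k) (\<theta> $ k) \<le> u)"
  by (simp add: gmax_def)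

lemma gmax_upper: "g k (x $ k) (\<theta> $ k) \<le> gmax g x \<theta>"
  by (simp add: gmax_def)

lemma gmax_attained: "\<exists>k. g k (x $ k) (\<theta> $ k) = gmax g x \<theta>"
proof -
  have "gmax g x \<theta> \<in> range (\<lambda>k. g k (x $ k) (\<theta> $ k))" unfolding gmax_def by (rule Max_in) auto
  then show ?thesis by auto
qed

lemma finite_vertices_polytope:
  fixes Q :: "'a::euclidean_space set"
  shows "polytope Q \<Longrightarrow> finite (vertices Q)"
  unfolding vertices_def by (intro finite_polyhedron_extreme_points polytope_imp_polyhedron)

section \<open>Risk and adversarial complexity\<close>

theorem theorem1:
  fixes X :: "'t::{finite,linorder} \<Rightarrow> (real^'n) set"
    and f :: "real^'n \<Rightarrow> 'w::topological_space \<Rightarrow> real^'n"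
    and P :: "('n,'t) series measure"
    and N :: nat
    and g :: "'t \<Rightarrow> real^'n \<Rightarrow> real^'p \<Rightarrow> real"
    and \<Theta>c :: "'t \<Rightarrow> (real^'p) set"
    and \<Theta> :: "('p,'t) series set"
    and S :: "(real^'n) set \<Rightarrow> real"
    and \<rho> \<beta> R :: real
    and d :: "('n,'t) series \<Rightarrow> ('n,'t) series \<Rightarrow> real"
    and A Ah Q :: "('n,'t) series \<Rightarrow> ('n,'t) series set"
    and PN :: "(nat \<Rightarrow> ('n,'t) series) measure"
    and \<theta>s :: "(nat \<Rightarrow> ('n,'t) series) \<Rightarrow> ('p,'t) series"
    and \<R>s :: "(nat \<Rightarrow> ('n,'t) series) \<Rightarrow> 't \<Rightarrow> (real^'n) set"
    and s :: "(nat \<Rightarrow> ('n,'t) series) \<Rightarrow> nat"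
  defines "A \<equiv> adv_set d R"
    and "PN \<equiv> Pi\<^sub>M {1..N} (\<lambda>_. P)"
    and "\<theta>s \<equiv> opt_param g S \<rho> \<Theta> Q N"
    and "\<R>s \<equiv> (\<lambda>\<omega> k. reach_set g k (\<theta>s \<omega> $ k))"
    and "s \<equiv> (\<lambda>\<omega>. adv_complexity g A Ah N \<omega> (\<theta>s \<omega>))"
  assumes "N \<ge> 1" and "0 < \<beta>" and "\<beta> < 1" and "\<rho> > 0"
    \<comment> \<open>trajectories of the system, with their distribution\<close>
    and "prob_space P" and "sets P = sets (restrict_space borel (traj_space X))"
    and "continuous_on ((\<Union>k. X k) \<times> UNIV) (\<lambda>(z, w). f z w)"
    and "AE x in P. follows_dynamics f x"
    \<comment> \<open>adversarial sets and their approximations, which are approximations from inside\<close>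
    and "Metric_space UNIV d" and "0 \<le> R"
    and "\<And>x. x \<in> traj_space X \<Longrightarrow> Ah x \<subseteq> A x"
    and "\<And>x. x \<in> traj_space X \<Longrightarrow> polytope (Q x) \<and> vertices (Q x) \<subseteq> Ah x"
    \<comment> \<open>convexity\<close>
    and "\<And>\<theta> k. \<theta> \<in> \<Theta> \<Longrightarrow> \<theta> $ k \<in> \<Theta>c k"
    and "\<And>k. convex_on (\<Theta>c k) (\<lambda>p. S (reach_set g k p))"
    and "\<And>x. convex_on \<Theta> (gmax g x)"
    \<comment> \<open>uniqueness\<close>
    and "\<And>\<omega>. \<omega> \<in> space PN \<Longrightarrow> \<exists>!\<theta>. optimal g S \<rho> \<Theta> Q N \<omega> \<theta>"
    \<comment> \<open>non-accumulation\<close>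
    and "\<And>\<theta>. \<theta> \<in> \<Theta> \<Longrightarrow> {x \<in> space P. \<exists>x'\<in>Ah x. gmax g x' \<theta> = 0} \<in> null_sets P"
    \<comment> \<open>measurability\<close>
    and "\<theta>s \<in> borel_measurable PN"
    and "Measurable.pred (P \<Otimes>\<^sub>M restrict_space borel \<Theta>)
           (\<lambda>(x, \<theta>). adv_excluded A (\<lambda>k. reach_set g k (\<theta> $ k)) x)"
    and "Measurable.pred (P \<Otimes>\<^sub>M restrict_space borel \<Theta>)
           (\<lambda>(x, \<theta>). \<exists>x'\<in>Ah x. gmax g x' \<theta> = 0)"
  shows "measure PN {\<omega> \<in> space PN.
           eps_lower N \<beta> (s \<omega>) \<le> exclusion_prob P A (\<R>s \<omega>) \<and>
           exclusion_prob P A (\<R>s \<omega>) \<le> eps_upper N \<beta> (s \<omega>)} \<ge> 1 - \<beta>"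
proof -
  define critical where "critical x \<theta> \<longleftrightarrow>
    adv_excluded A (\<lambda>k. reach_set g k (\<theta> $ k)) x \<or> (\<exists>x'\<in>Ah x. gmax g x' \<theta> = 0)"
    for x and \<theta> :: "('p,'t) series"
  define decision where "decision I \<omega> \<theta> \<longleftrightarrow>
    unique_minimiser \<Theta> (penalised_cost g S \<rho> Q I \<omega>) \<theta>" for I \<omega> \<theta>
  define L where "L = restrict_space borel \<Theta>"
  note N = \<open>N \<ge> 1\<close> and beta = \<open>0 < \<beta>\<close>
    and inner_approximation = assms(16) and polytopes = assms(17)
    and Theta_components = assms(18) and convex_size = assms(19) and convex_gmax = assms(20)
    and uniqueness = assms(21) and non_accumulation = assms(22) and measurability = assms(24,25)
  interpret P: prob_space P by fact
  have space_P: "space P = traj_space X"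
    using sets_eq_imp_space_eq[OF \<open>sets P = sets (restrict_space borel (traj_space X))\<close>]
    by (simp add: space_restrict_space)
  have space_L: "space L = \<Theta>" by (simp add: L_def space_restrict_space)
  have Ah_A: "Ah x \<subseteq> A x" and vert_Ah: "vertices (Q x) \<subseteq> Ah x" and fin: "finite (vertices (Q x))"
    if "x \<in> space P" for x
    using that inner_approximation[of x] polytopes[of x] finite_vertices_polytope by (auto simp: space_P)
  have convex_Theta: "convex \<Theta>"
    using convex_gmax by (simp add: convex_on_def)
  have opt: "decision {1..N} \<omega> (\<theta>s \<omega>)" if "\<omega> \<in> space PN" for \<omega>
    unfolding decision_def \<theta>s_def
  proof (rule opt_param_unique_minimiser)
    show "0 \<le> \<rho>" using \<open>\<rho> > 0\<close> by simp
    show "\<exists>!\<theta>. optimal g S \<rho> \<Theta> Q N \<omega> \<theta>" by (rule uniqueness) (rule that)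
    show "finite (vertices (Q (\<omega> i)))" if "i \<in> {1..N}" for i
      using \<open>\<omega> \<in> space PN\<close> that by (intro fin) (auto simp: PN_def space_PiM)
  qed
  have opt_in: "\<theta>s \<omega> \<in> \<Theta>" if "\<omega> \<in> space PN" for \<omega>
    using opt[OF that] by (simp add: decision_def unique_minimiser_def)
  have noncritical_neg: "gmax g v \<theta> < 0" if "x \<in> space P" "\<not> critical x \<theta>" "v \<in> vertices (Q x)" for x \<theta> v
  proof -
    have "v \<in> Ah x" "v \<in> A x" using that vert_Ah Ah_A by blast+
    then have "gmax g v \<theta> \<noteq> 0" "gmax g v \<theta> \<le> 0"
      using that(2) by (auto simp: critical_def adv_excluded_def reach_set_def gmax_le_iff)
    then show ?thesis by simp
  qed
  interpret C: consistent_decision P L critical decision N \<theta>s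
  proof
    show "Measurable.pred (P \<Otimes>\<^sub>M L) (\<lambda>(x, \<theta>). critical x \<theta>)"
      using pred_intros_logic(5)[OF measurability]
      by (simp add: critical_def L_def case_prod_unfold)
    show "\<theta>s \<in> measurable (PiM {1..N} (\<lambda>_. P)) L"
      unfolding L_def using \<open>\<theta>s \<in> borel_measurable PN\<close> opt_in
      by (intro measurable_restrict_space2) (auto simp: PN_def)
    show "decision {1..N} \<omega> (\<theta>s \<omega>)" if "\<omega> \<in> space (PiM {1..N} (\<lambda>_. P))" for \<omega>
      using opt that by (simp add: PN_def)
    show "\<theta>' = \<theta>" if "decision I \<omega> \<theta>" "decision I \<omega> \<theta>'" for I \<omega> \<theta> \<theta>'
    proof (rule ccontr)
      assume "\<theta>' \<noteq> \<theta>"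
      then show False
        using that unfolding decision_def unique_minimiser_def by (metis linear)
    qed
    show "decision I \<omega> \<theta> \<longleftrightarrow> decision J \<omega> \<theta>"
      if J: "finite J" "I \<subseteq> J" and in_P: "\<And>j. j \<in> J \<Longrightarrow> \<omega> j \<in> space P"
        and nc: "\<And>j. j \<in> J - I \<Longrightarrow> \<not> critical (\<omega> j) \<theta>" for I J \<omega> \<theta>
    proof -
      have neg: "gmax g v \<theta> < 0" if "j \<in> J - I" "v \<in> vertices (Q (\<omega> j))" for j v
        using noncritical_neg[of "\<omega> j" \<theta> v] in_P nc that by blast
      have finJ: "finite (vertices (Q (\<omega> j)))" if "j \<in> J" for j
        using fin[OF in_P[OF that]] .
      show ?thesis
        unfolding decision_def penalised_cost_def
      proof (rule unique_minimiser_inactive_penalties[OF J])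
        show "0 \<le> real CARD('t) * \<rho>" using \<open>\<rho> > 0\<close> by simp
        show "convex_on \<Theta> (\<lambda>\<theta>. \<Sum>k\<in>UNIV. S (reach_set g k (\<theta> $ k)))"
        proof (rule convex_onI[OF _ convex_Theta])
          fix t :: real and x y assume t: "0 < t" "t < 1" and xy: "x \<in> \<Theta>" "y \<in> \<Theta>"
          have "S (reach_set g k (((1 - t) *\<^sub>R x + t *\<^sub>R y) $ k))
            \<le> (1 - t) * S (reach_set g k (x $ k)) + t * S (reach_set g k (y $ k))" for k
            using convex_onD[OF convex_size[of k], of t "x $ k" "y $ k"] t xy Theta_components by simp
          then show "(\<Sum>k\<in>UNIV. S (reach_set g k (((1 - t) *\<^sub>R x + t *\<^sub>R y) $ k)))
            \<le> (1 - t) * (\<Sum>k\<in>UNIV. S (reach_set g k (x $ k))) + t * (\<Sum>k\<in>UNIV. S (reach_set g k (y $ k)))"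
            unfolding sum_distrib_left sum.distrib[symmetric] by (rule sum_mono)
        qed
        show "convex_on \<Theta> (least_slack g (vertices (Q (\<omega> j))))" if "j \<in> J" for j
          by (rule convex_on_least_slack[OF finJ[OF that] convex_Theta convex_gmax])
        show "0 \<le> least_slack g (vertices (Q (\<omega> j))) \<theta>'" if "j \<in> J" for j \<theta>'
          by (rule least_slack_ge(1)[OF finJ[OF that]])
        show "least_slack g (vertices (Q (\<omega> j))) \<theta> = 0" if "j \<in> J - I" for j
          using that neg finJ by (intro least_slack_eq_0) (auto intro: less_imp_le)
        show "\<forall>\<^sub>F t in at_right 0. least_slack g (vertices (Q (\<omega> j))) ((1 - t) *\<^sub>R \<theta> + t *\<^sub>R \<theta>') = 0"
          if "j \<in> J - I" "\<theta> \<in> \<Theta>" "\<theta>' \<in> \<Theta>" for j \<theta>'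
          using that neg finJ by (intro least_slack_eq_0_nearby[of _ \<Theta>] convex_gmax) auto
      qed
    qed
    show "decision I \<omega>' \<theta> \<longleftrightarrow> decision (h ` I) \<omega> \<theta>"
      if h: "inj_on h I" and eq: "\<And>i. i \<in> I \<Longrightarrow> \<omega>' i = \<omega> (h i)" for h I \<omega> \<omega>' \<theta>
    proof -
      have "penalised_cost g S \<rho> Q I \<omega>' = penalised_cost g S \<rho> Q (h ` I) \<omega>"
        by (intro ext) (simp add: penalised_cost_def sum.reindex[OF h] eq)
      then show ?thesis by (simp add: decision_def)
    qed
  qed
  \<comment> \<open>the two notions of risk agree since accumulation on the boundary has probability zero\<close>
  have risk: "C.risk \<theta> = exclusion_prob P A (\<lambda>k. reach_set g k (\<theta> $ k))" if "\<theta> \<in> \<Theta>" for \<theta>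
  proof -
    let ?E = "{x \<in> space P. adv_excluded A (\<lambda>k. reach_set g k (\<theta> $ k)) x}"
    let ?Z = "{x \<in> space P. \<exists>x'\<in>Ah x. gmax g x' \<theta> = 0}"
    have "(\<lambda>x. (x, \<theta>)) \<in> measurable P (P \<Otimes>\<^sub>M restrict_space borel \<Theta>)"
      using that by (intro measurable_Pair) (auto simp: space_restrict_space)
    from measurable_compose[OF this measurability(1)]
    have "?E \<in> sets P" by (simp add: pred_def)
    moreover have "?Z \<in> null_sets P" by (rule non_accumulation) (rule that)
    moreover have "{x \<in> space P. critical x \<theta>} = ?E \<union> ?Z" by (auto simp: critical_def)
    ultimately show ?thesis
      unfolding C.risk_def exclusion_prob_def by (simp add: measure_Un_null_set)
  qed
  have complexity: "s \<omega> = card (C.critical_indices {1..N} \<omega> (\<theta>s \<omega>))" if "\<omega> \<in> space PN" for \<omega>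
  proof -
    have equivalence: "(\<exists>x'\<in>Ah x. \<exists>k. g k (x' $ k) (\<theta> $ k) > 0) \<or> (\<exists>x'\<in>Ah x. \<exists>k. g k (x' $ k) (\<theta> $ k) = 0) \<or>
          (\<exists>x'\<in>A x. \<exists>k. g k (x' $ k) (\<theta> $ k) > 0) \<longleftrightarrow> critical x \<theta>" (is "?l \<longleftrightarrow> _")
      if x: "x \<in> space P" for x \<theta>
    proof
      have excl: "adv_excluded A (\<lambda>k. reach_set g k (\<theta> $ k)) x \<longleftrightarrow>
          (\<exists>x'\<in>A x. \<exists>k. g k (x' $ k) (\<theta> $ k) > 0)"
        by (auto simp: adv_excluded_def reach_set_def not_le)
      show "critical x \<theta>" if ?l
      proof (cases "\<exists>x'\<in>A x. \<exists>k. g k (x' $ k) (\<theta> $ k) > 0")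
        case True
        then show ?thesis by (simp add: critical_def excl)
      next
        case False
        then have le: "gmax g x' \<theta> \<le> 0" if "x' \<in> Ah x" for x'
          using Ah_A[OF x] that by (auto simp: gmax_le_iff not_less)
        obtain x' k where x': "x' \<in> Ah x" "g k (x' $ k) (\<theta> $ k) = 0"
          using \<open>?l\<close> False Ah_A[OF x] by blast
        have "0 \<le> gmax g x' \<theta>" using gmax_upper[of g k x' \<theta>] x'(2) by simp
        then have "gmax g x' \<theta> = 0" using le[OF x'(1)] by simp
        then show ?thesis using x'(1) by (auto simp: critical_def)
      qed
      show ?l if "critical x \<theta>"
        using that gmax_attained[of g _ \<theta>] unfolding critical_def excl by metis
    qed
    have "\<omega> i \<in> space P" if "i \<in> {1..N}" for i
      using \<open>\<omega> \<in> space PN\<close> that by (auto simp: PN_def space_PiM)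
    then show ?thesis
      unfolding s_def adv_complexity_def C.critical_indices_def
      by (intro arg_cong[where f = card] Collect_cong conj_cong refl equivalence)
  qed
  define bad where "bad k = {v. v < eps_lower N \<beta> k \<or> eps_upper N \<beta> k < v}" for k
  define B where "B = {\<omega> \<in> space PN. C.risk (\<theta>s \<omega>) \<in> bad (card (C.critical_indices {1..N} \<omega> (\<theta>s \<omega>)))}"
  have bad_borel: "bad k \<in> sets borel" for k
  proof -
    have "bad k = {..<eps_lower N \<beta> k} \<union> {eps_upper N \<beta> k<..}" by (auto simp: bad_def)
    then show ?thesis by simp
  qed
  have dual: "of_nat (N choose k) \<le>
      (\<Sum>m\<in>dual_sizes N. multiplier N \<beta> m * of_nat (m choose k) * sample_weight N m v)"
    if "k \<le> N" "v \<in> bad k" "0 \<le> v" "v \<le> 1" for k v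
  proof (rule multiplier_dual_feasible[OF N beta that(1,4)])
    show "level_poly N \<beta> k (1 - v) \<le> 0"
    proof (cases "eps_upper N \<beta> k < v")
      case True
      then show ?thesis
        using level_poly_nonpos_below_roots[OF N beta that(1), of "1 - v"] that by (simp add: eps_upper_def)
    next
      case False
      then have "v < 1 - t_upper N \<beta> k"
        using that by (auto simp: bad_def eps_lower_def)
      then show ?thesis
        using level_poly_nonpos_above_roots[OF N beta that(1), of "1 - v"] that by simp
    qed
  qed
  have B: "B \<in> sets PN" and "emeasure PN B \<le> ennreal \<beta>"
    using C.risk_complexity_bound[of bad "multiplier N \<beta>" "dual_sizes N", OF bad_borel dual]
      sum_multiplier[OF N beta] by (simp_all add: B_def PN_def)
  interpret PN: prob_space PN unfolding PN_def by (rule C.prob_space_samples)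
  have "measure PN B \<le> \<beta>"
    using \<open>emeasure PN B \<le> ennreal \<beta>\<close> beta by (simp add: PN.emeasure_eq_measure)
  moreover have "{\<omega> \<in> space PN.
           eps_lower N \<beta> (s \<omega>) \<le> exclusion_prob P A (\<R>s \<omega>) \<and>
           exclusion_prob P A (\<R>s \<omega>) \<le> eps_upper N \<beta> (s \<omega>)} = space PN - B"
    using risk opt_in complexity by (auto simp: B_def bad_def \<R>s_def not_less)
  ultimately show ?thesis using PN.prob_compl[OF B] by simp
qed

end
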